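(* (a) Let $(p_0,p_1,p_2,p_3)\in[0,1]^4$. Assume that for every $N\ge3$ the $N$-player Markov chain with parameter vector $(p_0,p_1,p_2,p_3)$ is ergodic, so that $\mu_B^N:=\mu^N(p_0,p_1,p_2,p_3)$ is defined for all $N\ge3$, and assume that the spin system on ${\bf Z}$ with parameter vector $(p_0,p_1,p_2,p_3)$ is ergodic. Then $\lim_{N\to\infty}\mu_B^N$ exists. (b) Let $(p_0,p_1,p_2,p_3)\in[0,1]^4$ and assume only that $(p_0,p_1,p_2,p_3)$ is not equal to $(0,0,1,0)$, $(0,1,0,0)$, $(1,0,1,1)$, or $(1,1,0,1)$. Let $$\mu_C^N:=\mu^N\big(\tfrac12(\tfrac12+p_0),\tfrac12(\tfrac12+p_1),\tfrac12(\tfrac12+p_2),\tfrac12(\tfrac12+p_3)\big),\qquad N\ge3.$$ Then $\lim_{N\to\infty}\mu_C^N$ exists.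
   Context: $N$-player Markov chain. For $N\ge3$ and $p_0,p_1,p_2,p_3\in[0,1]$, put $q_m:=1-p_m$. The state space is $\Sigma:=\{0,1\}^N$; for $\boldsymbol x=(x_1,\dots,x_N)\in\Sigma$ indices are cyclic ($x_0:=x_N$, $x_{N+1}:=x_1$), $m_i(\boldsymbol x):=2x_{i-1}+x_{i+1}\in\{0,1,2,3\}$, and $\boldsymbol x^i$ is $\boldsymbol x$ with the $i$th component replaced by $1-x_i$. The $N$-player Markov chain with parameter vector $(p_0,p_1,p_2,p_3)$ is the discrete-time chain in $\Sigma$ with $P(\boldsymbol x,\boldsymbol x^i)=N^{-1}p_{m_i(\boldsymbol x)}$ if $x_i=0$, $P(\boldsymbol x,\boldsymbol x^i)=N^{-1}q_{m_i(\boldsymbol x)}$ if $x_i=1$ ($i=1,\dots,N$), $P(\boldsymbol x,\boldsymbol x)=N^{-1}\big(\sum_{i:x_i=0}q_{m_i(\boldsymbol x)}+\sum_{i:x_i=1}p_{m_i(\boldsymbol x)}\big)$, and $P(\boldsymbol x,\boldsymbol y)=0$ otherwise. The chain is called ergodic if it has a unique stationary distribution and the distribution at time $n$ converges to it as $n\to\infty$, whatever the initial distribution. Mean profit. At each step a player $i$ is chosen uniformly from $\{1,\dots,N\}$; he wins one unit with probability $p_{m_i(\boldsymbol x)}$ (his status becomes 1) and loses one unit with probability $q_{m_i(\boldsymbol x)}$ (his status becomes 0). When the chain is ergodic with stationary distribution $\boldsymbol\pi$, the almost sure limit of the total profit of the ensemble of $N$ players after $n$ turns, divided by $n$, is $$\mu^N(p_0,p_1,p_2,p_3)=\frac1N\sum_{\boldsymbol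 x\in\Sigma}\pi(\boldsymbol x)\sum_{i=1}^N[p_{m_i(\boldsymbol x)}-q_{m_i(\boldsymbol x)}].$$ In part (b) the parameters used lie in $[1/4,3/4]$, so the chain is ergodic for every $N\ge3$. Spin system. For $\boldsymbol x\in\{0,1\}^{\bf Z}$ let $m_i(\boldsymbol x):=2x_{i-1}+x_{i+1}$ and let $\boldsymbol x^i$ be $\boldsymbol x$ with the $i$th component flipped. The spin system on ${\bf Z}$ with parameter vector $(p_0,p_1,p_2,p_3)$ is the Feller process in $\{0,1\}^{\bf Z}$ whose generator is the closure of $(\mathscr{L}f)(\boldsymbol x)=\sum_{i\in{\bf Z}}c_i(\boldsymbol x)[f(\boldsymbol x^i)-f(\boldsymbol x)]$, acting on functions $f$ depending on only finitely many components, where $c_i(\boldsymbol x)=p_{m_i(\boldsymbol x)}$ if $x_i=0$ and $c_i(\boldsymbol x)=q_{m_i(\boldsymbol x)}$ if $x_i=1$. It is ergodic if it has a unique stationary distribution $\pi$ and, for every initial distribution, the process at time $t$ converges in distribution to $\pi$ as $t\to\infty$. *)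

theory Defs
  imports "HOL-Probability.Probability"
begin

text \<open>
  A parameter vector \<open>(p\<^sub>0, p\<^sub>1, p\<^sub>2, p\<^sub>3)\<close> is a function \<open>p :: nat \<Rightarrow> real\<close> of which only the values
  at \<open>0, 1, 2, 3\<close> are used. The statuses \<open>0\<close> and \<open>1\<close> are \<open>False\<close> and \<open>True\<close>.
\<close>

definition nbr_code :: "bool \<Rightarrow> bool \<Rightarrow> nat" where
  "nbr_code l r = 2 * of_bool l + of_bool r"

subsection \<open>The \<open>N\<close>-player Markov chain\<close>

definition player_states :: "nat \<Rightarrow> (nat \<Rightarrow> bool) set" where
  "player_states N = {1..N} \<rightarrow>\<^sub>E UNIV"

definition player_code :: "nat \<Rightarrow> (nat \<Rightarrow> bool) \<Rightarrow> nat \<Rightarrow> nat" where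
  "player_code N x i =
     nbr_code (x (if i = 1 then N else i - 1)) (x (if i = N then 1 else i + 1))"

definition flip :: "('i \<Rightarrow> bool) \<Rightarrow> 'i \<Rightarrow> ('i \<Rightarrow> bool)" where
  "flip x i = x(i := \<not> x i)"

text \<open>
  For \<open>y \<noteq> x\<close> at most one \<open>i\<close> satisfies \<open>y = flip x i\<close>, so the last sum below has at most one term.
\<close>

definition player_trans :: "(nat \<Rightarrow> real) \<Rightarrow> nat \<Rightarrow> (nat \<Rightarrow> bool) \<Rightarrow> (nat \<Rightarrow> bool) \<Rightarrow> real" where
  "player_trans p N x y =
     (if y = x then
        ((\<Sum>i\<in>{i\<in>{1..N}. \<not> x i}. 1 - p (player_code N x i)) +
         (\<Sum>i\<in>{i\<in>{1..N}. x i}. p (player_code N x i))) / real N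
      else
        (\<Sum>i\<in>{i\<in>{1..N}. y = flip x i}.
           (if x i then 1 - p (player_code N x i) else p (player_code N x i)) / real N))"

definition player_dist :: "nat \<Rightarrow> (nat \<Rightarrow> bool) pmf \<Rightarrow> bool" where
  "player_dist N \<nu> \<longleftrightarrow> set_pmf \<nu> \<subseteq> player_states N"

primrec player_law ::
  "(nat \<Rightarrow> real) \<Rightarrow> nat \<Rightarrow> (nat \<Rightarrow> bool) pmf \<Rightarrow> nat \<Rightarrow> (nat \<Rightarrow> bool) \<Rightarrow> real" where
  "player_law p N \<nu> 0 = pmf \<nu>"
| "player_law p N \<nu> (Suc n) =
     (\<lambda>y. \<Sum>x\<in>player_states N. player_law p N \<nu> n x * player_trans p N x y)"

definition player_stationary :: "(nat \<Rightarrow> real) \<Rightarrow> nat \<Rightarrow> (nat \<Rightarrow> bool) pmf \<Rightarrow> bool" where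
  "player_stationary p N \<pi> \<longleftrightarrow> player_dist N \<pi> \<and>
     (\<forall>y\<in>player_states N. (\<Sum>x\<in>player_states N. pmf \<pi> x * player_trans p N x y) = pmf \<pi> y)"

definition player_ergodic :: "(nat \<Rightarrow> real) \<Rightarrow> nat \<Rightarrow> bool" where
  "player_ergodic p N \<longleftrightarrow>
     (\<exists>\<pi>. player_stationary p N \<pi> \<and>
          (\<forall>\<pi>'. player_stationary p N \<pi>' \<longrightarrow> \<pi>' = \<pi>) \<and>
          (\<forall>\<nu>. player_dist N \<nu> \<longrightarrow>
             (\<forall>y\<in>player_states N. (\<lambda>n. player_law p N \<nu> n y) \<longlonglongrightarrow> pmf \<pi> y)))"

text \<open>Only meaningful if the stationary distribution is unique, in particular for ergodic chains.\<close>

definition mean_profit :: "nat \<Rightarrow> (nat \<Rightarrow> real) \<Rightarrow> real" where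
  "mean_profit N p =
     1 / real N *
     (\<Sum>x\<in>player_states N. pmf (THE \<pi>. player_stationary p N \<pi>) x *
        (\<Sum>i=1..N. p (player_code N x i) - (1 - p (player_code N x i))))"

subsection \<open>The spin system on the integers\<close>

text \<open>
  \<open>int \<Rightarrow> bool\<close> carries the product topology and is compact, so the Banach space \<open>C(int \<Rightarrow> bool)\<close> is
  the library type \<open>(int \<Rightarrow> bool) \<Rightarrow>\<^sub>C real\<close> of bounded continuous functions with the sup norm.
  A Feller process is given by its transition function \<open>P\<close>, where \<open>P t x\<close> is the
  distribution at time \<open>t \<ge> 0\<close> of the process started at \<open>x\<close>.
\<close>

type_synonym config = "int \<Rightarrow> bool"

definition feller_transition :: "(real \<Rightarrow> config \<Rightarrow> config measure) \<Rightarrow> bool" where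
  "feller_transition P \<longleftrightarrow>
     (\<forall>t\<ge>0. P t \<in> borel \<rightarrow>\<^sub>M prob_algebra borel) \<and>
     (\<forall>x. P 0 x = return borel x) \<and>
     (\<forall>s\<ge>0. \<forall>t\<ge>0. \<forall>x. P (s + t) x = P s x \<bind> P t) \<and>
     (\<forall>t\<ge>0. \<forall>f :: config \<Rightarrow>\<^sub>C real. continuous_on UNIV (\<lambda>x. LINT y|P t x. f y)) \<and>
     (\<forall>f :: config \<Rightarrow>\<^sub>C real. uniform_limit UNIV (\<lambda>t x. LINT y|P t x. f y) f (at_right 0))"

text \<open>Operators on \<open>C(int \<Rightarrow> bool)\<close> with a restricted domain are represented by their graphs.\<close>

definition generator ::
  "(real \<Rightarrow> config \<Rightarrow> config measure) \<Rightarrow> ((config \<Rightarrow>\<^sub>C real) \<times> (config \<Rightarrow>\<^sub>C real)) set" where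
  "generator P =
     {(f, g).
        uniform_limit UNIV
          (\<lambda>t x. ((LINT y|P t x. apply_bcontfun f y) - apply_bcontfun f x) / t)
          (apply_bcontfun g) (at_right 0)}"

definition spin_rate :: "(nat \<Rightarrow> real) \<Rightarrow> config \<Rightarrow> int \<Rightarrow> real" where
  "spin_rate p x i =
     (if x i then 1 - p (nbr_code (x (i - 1)) (x (i + 1)))
      else p (nbr_code (x (i - 1)) (x (i + 1))))"

definition cylinder_fun :: "(config \<Rightarrow> real) \<Rightarrow> bool" where
  "cylinder_fun f \<longleftrightarrow> (\<exists>J. finite J \<and> (\<forall>x y. (\<forall>j\<in>J. x j = y j) \<longrightarrow> f x = f y))"

text \<open>If \<open>f\<close> is a cylinder function, only finitely many terms of the sum below are nonzero.\<close>

definition spin_pregenerator ::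
  "(nat \<Rightarrow> real) \<Rightarrow> ((config \<Rightarrow>\<^sub>C real) \<times> (config \<Rightarrow>\<^sub>C real)) set" where
  "spin_pregenerator p =
     {(f, g). cylinder_fun (apply_bcontfun f) \<and>
        (\<forall>x. apply_bcontfun g x =
             (\<Sum>\<^sub>\<infinity>i. spin_rate p x i * (apply_bcontfun f (flip x i) - apply_bcontfun f x)))}"

definition spin_system :: "(nat \<Rightarrow> real) \<Rightarrow> (real \<Rightarrow> config \<Rightarrow> config measure) \<Rightarrow> bool" where
  "spin_system p P \<longleftrightarrow> feller_transition P \<and> generator P = closure (spin_pregenerator p)"

definition config_dist :: "config measure \<Rightarrow> bool" where
  "config_dist \<nu> \<longleftrightarrow> \<nu> \<in> space (prob_algebra borel)"

definition process_stationary ::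
  "(real \<Rightarrow> config \<Rightarrow> config measure) \<Rightarrow> config measure \<Rightarrow> bool" where
  "process_stationary P \<pi> \<longleftrightarrow> config_dist \<pi> \<and> (\<forall>t\<ge>0. \<pi> \<bind> P t = \<pi>)"

definition converges_in_distribution ::
  "('t \<Rightarrow> config measure) \<Rightarrow> config measure \<Rightarrow> 't filter \<Rightarrow> bool" where
  "converges_in_distribution \<nu> \<pi> F \<longleftrightarrow>
     (\<forall>f :: config \<Rightarrow>\<^sub>C real. ((\<lambda>t. LINT x|\<nu> t. f x) \<longlongrightarrow> (LINT x|\<pi>. f x)) F)"

definition process_ergodic :: "(real \<Rightarrow> config \<Rightarrow> config measure) \<Rightarrow> bool" where
  "process_ergodic P \<longleftrightarrow>
     (\<exists>\<pi>. process_stationary P \<pi> \<and>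
          (\<forall>\<pi>'. process_stationary P \<pi>' \<longrightarrow> \<pi>' = \<pi>) \<and>
          (\<forall>\<nu>. config_dist \<nu> \<longrightarrow> converges_in_distribution (\<lambda>t. \<nu> \<bind> P t) \<pi> at_top))"

end

theory Submission imports Defs begin

text \<open>
  Draw a state of the \<open>N\<close>-player chain from its stationary distribution, choose one player uniformly,
  and repeat the cyclic state periodically along the integers with the chosen player at the origin.
  Averaging a function over this random configuration gives the profile mean. A player sees only his
  two neighbours, so the mean profit is the profile mean of a single function of the coordinates
  \<open>- 1\<close> and \<open>1\<close> that does not change with \<open>N\<close> (\<open>mean_profit_eq_profile_mean\<close>). For a function \<open>f\<close>
  of finitely many coordinates, stationarity on a cycle longer than the window of \<open>f\<close> implies
  that the profile mean of the generator of the spin system applied to \<open>f\<close> is zero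
  (\<open>profile_mean_generator\<close>). By Tychonoff's theorem every subsequence of profile means has limit
  points, which are positive normalized linear functionals that annihilate the generator on all such
  \<open>f\<close>. Hence the mean profit converges as soon as all functionals of this kind agree on one function
  (\<open>mean_profit_tendsto\<close>). The two parts differ in how this agreement is shown.

  In part (a) the functional is integration against a probability measure: it is additive on the
  algebra of cylinder sets, and compactness makes it countably additive (\<open>mean_functional_measure\<close>).
  The measure annihilates the closure of the pregenerator, that is, the generator \<open>G\<close> of the semigroup
  \<open>S\<close>. As \<open>S\<close> preserves the domain of \<open>G\<close>, the integral of \<open>S t f\<close> has derivative zero in \<open>t\<close>, so the
  measure is stationary (\<open>spin_stationary\<close>), and by ergodicity there is only one such measure.

  Part (b) uses duality. Encode statuses as signs and let \<open>walsh A\<close> be the product of the signs on \<open>A\<close>.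
  The generator acts on it like a branching process on \<open>A\<close>: each site, at rate one, is erased,
  moved to its left neighbour, moved to its right neighbour, or replaced by both, with signed weights
  \<open>a, b, c, d\<close>, the coefficients of the update rule as a function of the two neighbouring signs; sites
  meeting on the same place cancel. Averaging every parameter with \<open>1/2\<close> makes the absolute values of
  the weights sum to at most one, with equality only if all are \<open>1/4\<close>, in which case the branching is
  critical and still dies out (\<open>dual_moments_vanish\<close>). So two functionals that annihilate the generator
  agree on all \<open>walsh A\<close>. The same argument on the cycle proves that the chain has only one stationary
  distribution.
\<close>

section \<open>Positive normalized functionals and their limit points\<close>

lemma bounded_range_sum:
  fixes f :: "'i \<Rightarrow> 'a \<Rightarrow> real"
  assumes "finite I" "\<And>i. i \<in> I \<Longrightarrow> bounded (range (f i))"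
  shows "bounded (range (\<lambda>x. \<Sum>i\<in>I. f i x))"
  using assms by (induction I rule: finite_induct) (auto intro: bounded_plus_comp)

lemma bounded_range_scale:
  fixes f :: "'a \<Rightarrow> real"
  assumes "bounded (range f)"
  shows "bounded (range (\<lambda>x. c * f x))"
  using bounded_scaleR_comp[OF assms, of c] by simp

lemma bounded_indicator: "bounded (range (indicator A :: 'a \<Rightarrow> real))"
  by (auto simp: bounded_iff indicator_def intro!: exI[of _ 1])

text \<open>
  Finitely additive expectations of bounded functions. Countable additivity is not demanded, because
  pointwise limits of expectations may lose it.
\<close>

locale mean_functional =
  fixes E :: "('a \<Rightarrow> real) \<Rightarrow> real"
  assumes mean_one: "E (\<lambda>_. 1) = 1"
    and mean_nonneg: "bounded (range f) \<Longrightarrow> (\<And>x. 0 \<le> f x) \<Longrightarrow> 0 \<le> E f"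
    and mean_add: "bounded (range f) \<Longrightarrow> bounded (range g) \<Longrightarrow> E (\<lambda>x. f x + g x) = E f + E g"
    and mean_scale: "bounded (range f) \<Longrightarrow> E (\<lambda>x. c * f x) = c * E f"
begin

lemma mean_diff:
  assumes "bounded (range f)" "bounded (range g)"
  shows "E (\<lambda>x. f x - g x) = E f - E g"
proof -
  have "bounded (range (\<lambda>x. f x - g x))"
    using assms by (rule bounded_minus_comp)
  from mean_add[OF this assms(2)] show ?thesis by simp
qed

lemma mean_const: "E (\<lambda>_. c) = c"
proof -
  have "bounded (range (\<lambda>_::'a. 1::real))" by simp
  from mean_scale[OF this, of c] show ?thesis using mean_one by simp
qed

lemma mean_mono:
  assumes "bounded (range f)" "bounded (range g)" "\<And>x. f x \<le> g x"
  shows "E f \<le> E g"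
proof -
  have "0 \<le> E (\<lambda>x. g x - f x)"
    using assms by (intro mean_nonneg bounded_minus_comp) auto
  then show ?thesis using mean_diff[OF assms(2,1)] by simp
qed

lemma mean_abs_le:
  assumes "\<And>x. \<bar>f x\<bar> \<le> B"
  shows "\<bar>E f\<bar> \<le> B"
proof -
  have bf: "bounded (range f)"
    using assms by (auto simp: bounded_iff)
  have "f x \<le> B" "- B \<le> f x" for x using assms[of x] by linarith+
  then have "E f \<le> E (\<lambda>_. B)" "E (\<lambda>_. - B) \<le> E f"
    by (intro mean_mono bf; simp)+
  then show ?thesis by (simp add: mean_const abs_le_iff)
qed

lemma mean_sum:
  assumes "finite I" "\<And>i. i \<in> I \<Longrightarrow> bounded (range (f i))"
  shows "E (\<lambda>x. \<Sum>i\<in>I. f i x) = (\<Sum>i\<in>I. E (f i))"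
  using assms
proof (induction I rule: finite_induct)
  case empty
  show ?case using mean_const[of 0] by simp
next
  case (insert i I)
  have "bounded (range (\<lambda>x. \<Sum>j\<in>I. f j x))"
    using insert by (intro bounded_range_sum) auto
  then show ?case using insert by (simp add: mean_add)
qed

end

text \<open>
  Tychonoff's theorem, for the space in which a net of functionals is placed by evaluating each one
  at all functions simultaneously.
\<close>

lemma compact_pointwise_bounded:
  fixes B :: "'i \<Rightarrow> real"
  shows "compact {h. \<forall>i. h i \<in> {- B i..B i}}"
proof -
  have "compactin (product_topology (\<lambda>_. euclideanreal) UNIV) (PiE UNIV (\<lambda>i. {- B i..B i}))"
    by (subst compactin_PiE) auto
  moreover have "PiE UNIV (\<lambda>i. {- B i..B i}) = {h. \<forall>i. h i \<in> {- B i..B i}}"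
    by (auto simp: PiE_def Pi_def)
  ultimately show ?thesis
    by (simp add: euclidean_product_topology)
qed

text \<open>
  Limit points are described by a finer filter \<open>G\<close> and not by a subsequence: the functionals are
  evaluated at uncountably many functions, so a limit point need not be the limit of a subsequence.
  Along \<open>G\<close> everything converges, and identities pass to the limit as usual.
\<close>

lemma mean_functional_cluster:
  fixes E :: "'n \<Rightarrow> ('a \<Rightarrow> real) \<Rightarrow> real"
  assumes "F \<noteq> bot" and mean: "eventually (\<lambda>n. mean_functional (E n)) F"
  shows "\<exists>\<Lambda> G. G \<noteq> bot \<and> G \<le> F \<and> mean_functional \<Lambda> \<and>
    (\<forall>f. bounded (range f) \<longrightarrow> ((\<lambda>n. E n f) \<longlongrightarrow> \<Lambda> f) G)"
proof -
  have "\<exists>B. bounded (range f) \<longrightarrow> (\<forall>x. \<bar>f x\<bar> \<le> B)" for f :: "'a \<Rightarrow> real"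
    by (auto simp: bounded_iff)
  then obtain B :: "('a \<Rightarrow> real) \<Rightarrow> real"
    where B: "\<And>f x. bounded (range f) \<Longrightarrow> \<bar>f x\<bar> \<le> B f"
    by metis
  define X where "X = (\<lambda>n f. if bounded (range f) then E n f else 0)"
  \<comment> \<open>Unbounded functions get the value \<open>0\<close>, so that every coordinate of \<open>X n\<close> lies in a compact interval.\<close>
  let ?K = "{h. \<forall>f. h f \<in> {- \<bar>B f\<bar>..\<bar>B f\<bar>}}"
  have "eventually (\<lambda>n. X n \<in> ?K) F"
    using mean
  proof eventually_elim
    case (elim n)
    interpret mean_functional "E n" by (rule elim)
    have "\<bar>E n f\<bar> \<le> B f" if "bounded (range f)" for f
      using B[OF that] by (rule mean_abs_le)
    then show ?case by (force simp: X_def abs_le_iff)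
  qed
  then have "eventually (\<lambda>h. h \<in> ?K) (filtermap X F)"
    by (simp add: eventually_filtermap)
  moreover have "filtermap X F \<noteq> bot"
    using assms(1) by (simp add: filtermap_bot_iff)
  ultimately obtain \<Lambda> where cl: "inf (nhds \<Lambda>) (filtermap X F) \<noteq> bot"
    using compact_pointwise_bounded[of "\<lambda>f. \<bar>B f\<bar>"] unfolding compact_filter by blast
  define G where "G = inf F (filtercomap X (nhds \<Lambda>))"
  have "G \<noteq> bot"
  proof
    assume "G = bot"
    then obtain P Q where PQ: "eventually P F" "eventually Q (nhds \<Lambda>)" "\<And>n. P n \<Longrightarrow> Q (X n) \<Longrightarrow> False"
      unfolding G_def trivial_limit_def eventually_inf eventually_filtercomap by blast
    have "eventually (\<lambda>h. \<not> Q h) (filtermap X F)"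
      using PQ(1) unfolding eventually_filtermap by eventually_elim (use PQ(3) in blast)
    with PQ(2) have "eventually (\<lambda>_. False) (inf (nhds \<Lambda>) (filtermap X F))"
      unfolding eventually_inf by blast
    with cl show False by (simp add: trivial_limit_def)
  qed
  have "G \<le> F" by (simp add: G_def)
  have "filterlim X (nhds \<Lambda>) G"
    unfolding G_def by (meson filterlim_filtercomap filterlim_mono inf.cobounded2 order_refl)
  then have X_lim: "((\<lambda>n. X n f) \<longlongrightarrow> \<Lambda> f) G" for f
    by (rule continuous_on_tendsto_compose[OF continuous_on_product_coordinates]) auto
  have lim: "((\<lambda>n. E n f) \<longlongrightarrow> \<Lambda> f) G" if "bounded (range f)" for f
    using X_lim[of f] that by (simp add: X_def)
  have meanG: "eventually (\<lambda>n. mean_functional (E n)) G"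
    by (rule filter_leD[OF \<open>G \<le> F\<close> mean])
  have "mean_functional \<Lambda>"
  proof
    have "eventually (\<lambda>n. E n (\<lambda>_. 1) = 1) G"
      using meanG by eventually_elim (rule mean_functional.mean_one)
    then have "((\<lambda>n. E n (\<lambda>_. 1)) \<longlongrightarrow> 1) G"
      by (rule tendsto_eventually)
    then show "\<Lambda> (\<lambda>_. 1) = 1"
      by (intro tendsto_unique[OF \<open>G \<noteq> bot\<close> lim]) auto
  next
    fix f :: "'a \<Rightarrow> real" assume f: "bounded (range f)" "\<And>x. 0 \<le> f x"
    have "eventually (\<lambda>n. 0 \<le> E n f) G"
      using meanG by eventually_elim (use f mean_functional.mean_nonneg in blast)
    then show "0 \<le> \<Lambda> f"
      by (rule tendsto_lowerbound[OF lim[OF f(1)] _ \<open>G \<noteq> bot\<close>])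
  next
    fix f g :: "'a \<Rightarrow> real" assume fg: "bounded (range f)" "bounded (range g)"
    have "eventually (\<lambda>n. E n (\<lambda>x. f x + g x) = E n f + E n g) G"
      using meanG by eventually_elim (use fg mean_functional.mean_add in blast)
    then have "((\<lambda>n. E n (\<lambda>x. f x + g x)) \<longlongrightarrow> \<Lambda> f + \<Lambda> g) G"
      using tendsto_add[OF lim[OF fg(1)] lim[OF fg(2)]] by (simp add: tendsto_cong)
    then show "\<Lambda> (\<lambda>x. f x + g x) = \<Lambda> f + \<Lambda> g"
      by (rule tendsto_unique[OF \<open>G \<noteq> bot\<close> lim[OF bounded_plus_comp[OF fg]]])
  next
    fix f :: "'a \<Rightarrow> real" and c assume f: "bounded (range f)"
    have bcf: "bounded (range (\<lambda>x. c * f x))"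
      by (rule bounded_range_scale[OF f])
    have "eventually (\<lambda>n. E n (\<lambda>x. c * f x) = c * E n f) G"
      using meanG by eventually_elim (use f mean_functional.mean_scale in blast)
    then have "((\<lambda>n. E n (\<lambda>x. c * f x)) \<longlongrightarrow> c * \<Lambda> f) G"
      using tendsto_mult_left[OF lim[OF f], of c] by (simp add: tendsto_cong)
    then show "\<Lambda> (\<lambda>x. c * f x) = c * \<Lambda> f"
      by (rule tendsto_unique[OF \<open>G \<noteq> bot\<close> lim[OF bcf]])
  qed
  with \<open>G \<noteq> bot\<close> \<open>G \<le> F\<close> lim show ?thesis by blast
qed

text \<open>
  The usual principle that a relatively compact family converges when it has only one limit point,
  here required for a single test function \<open>\<phi>\<close> only. If convergence failed, some limit point along the
  indices \<open>n\<close> with \<open>E n \<phi>\<close> far from \<open>c\<close> would contradict the assumption.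
\<close>

lemma mean_functional_tendsto:
  assumes mean: "eventually (\<lambda>n. mean_functional (E n)) F" and "bounded (range \<phi>)"
    and unique: "\<And>\<Lambda> G. G \<noteq> bot \<Longrightarrow> G \<le> F \<Longrightarrow> mean_functional \<Lambda> \<Longrightarrow>
      (\<And>f. bounded (range f) \<Longrightarrow> ((\<lambda>n. E n f) \<longlongrightarrow> \<Lambda> f) G) \<Longrightarrow> \<Lambda> \<phi> = c"
  shows "((\<lambda>n. E n \<phi>) \<longlongrightarrow> c) F"
proof (rule ccontr)
  assume "\<not> ?thesis"
  then obtain e where e: "e > 0" "\<not> eventually (\<lambda>n. dist (E n \<phi>) c < e) F"
    by (auto simp: tendsto_iff)
  define F' where "F' = inf F (principal {n. \<not> dist (E n \<phi>) c < e})"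
  have "F' \<noteq> bot"
    using e(2) by (auto simp: F'_def trivial_limit_def eventually_inf_principal)
  moreover have "eventually (\<lambda>n. mean_functional (E n)) F'"
    using mean by (auto simp: F'_def eventually_inf_principal elim: eventually_mono)
  ultimately obtain \<Lambda> G where G: "G \<noteq> bot" "G \<le> F'" "mean_functional \<Lambda>"
    "\<And>f. bounded (range f) \<Longrightarrow> ((\<lambda>n. E n f) \<longlongrightarrow> \<Lambda> f) G"
    using mean_functional_cluster[of F' E] by blast
  have "\<Lambda> \<phi> = c"
    using G by (intro unique) (auto simp: F'_def)
  then have "eventually (\<lambda>n. dist (E n \<phi>) c < e) G"
    using G(4)[OF assms(2)] e(1) by (auto simp: tendsto_iff)
  moreover have "eventually (\<lambda>n. \<not> dist (E n \<phi>) c < e) G"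
    by (rule filter_leD[OF G(2)]) (simp add: F'_def eventually_inf_principal)
  ultimately have "eventually (\<lambda>_. False) G"
    by eventually_elim simp
  with G(1) show False by (simp add: trivial_limit_def)
qed

section \<open>Walsh functions and the dual branching process\<close>

definition spin :: "bool \<Rightarrow> real" where
  "spin b = (if b then 1 else - 1)"

definition walsh :: "'i set \<Rightarrow> ('i \<Rightarrow> bool) \<Rightarrow> real" where
  "walsh A x = (\<Prod>i\<in>A. spin (x i))"

text \<open>
  Adding a site to a set modulo two: multiplying a Walsh function by one more sign cancels the sign if
  it is already there.
\<close>

definition toggle :: "'i \<Rightarrow> 'i set \<Rightarrow> 'i set" where
  "toggle j A = (if j \<in> A then A - {j} else insert j A)"

text \<open>
  The common form of the flip rates on the cycle and on the integers: \<open>y\<close> is the status of the site,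
  \<open>l\<close> and \<open>r\<close> are those of its neighbours.
\<close>

definition flip_rate :: "(nat \<Rightarrow> real) \<Rightarrow> bool \<Rightarrow> bool \<Rightarrow> bool \<Rightarrow> real" where
  "flip_rate p y l r = (if y then 1 - p (nbr_code l r) else p (nbr_code l r))"

lemma spin_square: "spin b * spin b = 1"
  by (simp add: spin_def)

lemma abs_spin: "\<bar>spin b\<bar> = 1"
  by (simp add: spin_def)

lemma abs_walsh: "\<bar>walsh A x\<bar> = 1"
  by (simp add: walsh_def abs_prod abs_spin)

lemma bounded_walsh: "bounded (range (walsh A))"
  by (auto simp: bounded_iff abs_walsh)

lemma walsh_empty [simp]: "walsh {} = (\<lambda>_. 1)"
  by (simp add: walsh_def fun_eq_iff)

lemma walsh_remove: "finite A \<Longrightarrow> i \<in> A \<Longrightarrow> walsh A x = spin (x i) * walsh (A - {i}) x"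
  by (simp add: walsh_def prod.remove)

lemma walsh_toggle:
  assumes "finite A"
  shows "walsh (toggle j A) x = spin (x j) * walsh A x"
proof (cases "j \<in> A")
  case True
  have "spin (x j) * walsh A x = (spin (x j) * spin (x j)) * walsh (A - {j}) x"
    by (simp only: walsh_remove[OF assms True] mult.assoc)
  then show ?thesis using True by (simp add: toggle_def spin_square)
next
  case False
  then show ?thesis using assms by (simp add: toggle_def walsh_def)
qed

lemma walsh_flip_outside: "i \<notin> A \<Longrightarrow> walsh A (flip x i) = walsh A x"
  unfolding walsh_def flip_def by (intro prod.cong) auto

lemma walsh_flip:
  assumes "finite A" "i \<in> A"
  shows "walsh A (flip x i) = - walsh A x"
proof -
  have "walsh (A - {i}) (flip x i) = walsh (A - {i}) x"
    by (rule walsh_flip_outside) simp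
  moreover have "spin (flip x i i) = - spin (x i)"
    by (simp add: flip_def spin_def)
  ultimately show ?thesis
    by (simp add: walsh_remove[OF assms])
qed

lemma finite_toggle [simp]: "finite (toggle j A) \<longleftrightarrow> finite A"
  by (simp add: toggle_def)

lemma card_toggle_le: "card (toggle j A) \<le> Suc (card A)"
  by (cases "finite A") (auto simp: toggle_def card_insert_if intro: le_SucI card_Diff1_le)

lemma toggle_subset: "j \<in> S \<Longrightarrow> A \<subseteq> S \<Longrightarrow> toggle j A \<subseteq> S"
  by (auto simp: toggle_def)

text \<open>
  The duality relation. A site resamples its sign with conditional mean \<open>2 p - 1\<close>, whatever its present
  sign; expanding this mean in the signs of the neighbours turns the effect on a Walsh function into
  Walsh functions of sets in which \<open>i\<close> has been erased, moved or duplicated.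
\<close>

lemma walsh_flip_drift:
  assumes "finite A" "i \<in> A"
    and expand: "\<And>y z. 2 * p (nbr_code y z) - 1 = a + b * spin y + c * spin z + d * (spin y * spin z)"
  shows "flip_rate p (x i) (x l) (x r) * (walsh A (flip x i) - walsh A x) =
    a * walsh (A - {i}) x + b * walsh (toggle l (A - {i})) x + c * walsh (toggle r (A - {i})) x
      + d * walsh (toggle l (toggle r (A - {i}))) x - walsh A x"
proof -
  let ?w = "walsh (A - {i}) x"
  have rate: "2 * flip_rate p (x i) (x l) (x r) * spin (x i) =
      spin (x i) - (2 * p (nbr_code (x l) (x r)) - 1)"
    by (simp add: flip_rate_def spin_def)
  have "flip_rate p (x i) (x l) (x r) * (walsh A (flip x i) - walsh A x) =
      - (2 * flip_rate p (x i) (x l) (x r) * spin (x i)) * ?w"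
    unfolding walsh_flip[OF assms(1,2)] walsh_remove[OF assms(1,2), of x] by (simp add: algebra_simps)
  also have "\<dots> = (2 * p (nbr_code (x l) (x r)) - 1) * ?w - spin (x i) * ?w"
    unfolding rate by (simp add: algebra_simps)
  finally show ?thesis
    using assms(1) by (simp add: expand walsh_toggle walsh_remove[OF assms(1,2)] algebra_simps)
qed

text \<open>
  A bounded solution \<open>u\<close> of the dual equation, with \<open>u {} = 0\<close>, is bounded by \<open>K\<close> times the probability that the
  branching process with weights \<open>\<bar>a\<bar>\<close> (death), \<open>\<bar>b\<bar>, \<bar>c\<bar>\<close> (moves) and \<open>\<bar>d\<bar>\<close> (doubling) survives.
  If the weights sum to less than one, mass is lost at every step. Otherwise death must be possible and
  at least as likely as doubling; then the maximum \<open>w n\<close> of \<open>\<bar>u\<bar>\<close> over the sets with at most \<open>n\<close> elements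
  is convex in \<open>n\<close>, and a bounded nondecreasing convex sequence is constant, so equal to \<open>w 0 = 0\<close>.
  Cancellation of coinciding sites only makes sets smaller, which is why sets are measured by
  an upper bound on their size.
\<close>

lemma dual_moments_vanish:
  fixes u :: "'i set \<Rightarrow> real"
  assumes "u {} = 0" and bound: "\<And>A. \<bar>u A\<bar> \<le> K"
    and L: "\<And>i. i \<in> S \<Longrightarrow> L i \<in> S" and R: "\<And>i. i \<in> S \<Longrightarrow> R i \<in> S"
    and eq: "\<And>A. finite A \<Longrightarrow> A \<subseteq> S \<Longrightarrow> real (card A) * u A =
      (\<Sum>i\<in>A. a * u (A - {i}) + b * u (toggle (L i) (A - {i})) + c * u (toggle (R i) (A - {i}))
        + d * u (toggle (L i) (toggle (R i) (A - {i}))))"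
    and coeffs: "\<bar>a\<bar> + \<bar>b\<bar> + \<bar>c\<bar> + \<bar>d\<bar> \<le> 1"
      "\<bar>a\<bar> + \<bar>b\<bar> + \<bar>c\<bar> + \<bar>d\<bar> < 1 \<or> (0 < \<bar>a\<bar> \<and> \<bar>d\<bar> \<le> \<bar>a\<bar>)"
    and "finite A" "A \<subseteq> S"
  shows "u A = 0"
proof -
  \<comment> \<open>One step of the dual process: \<open>v0, v1, v2\<close> bound \<open>\<bar>u\<bar>\<close> on the sets it can reach by death, move and doubling.\<close>
  have step: "\<bar>u A\<bar> \<le> \<bar>a\<bar> * v0 + (\<bar>b\<bar> + \<bar>c\<bar>) * v1 + \<bar>d\<bar> * v2"
    if A: "finite A" "A \<subseteq> S" "A \<noteq> {}"
      and v: "\<And>B. finite B \<Longrightarrow> B \<subseteq> S \<Longrightarrow> card B < card A \<Longrightarrow> \<bar>u B\<bar> \<le> v0"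
        "\<And>B. finite B \<Longrightarrow> B \<subseteq> S \<Longrightarrow> card B \<le> card A \<Longrightarrow> \<bar>u B\<bar> \<le> v1"
        "\<And>B. finite B \<Longrightarrow> B \<subseteq> S \<Longrightarrow> card B \<le> Suc (card A) \<Longrightarrow> \<bar>u B\<bar> \<le> v2"
    for A v0 v1 v2
  proof -
    let ?t = "\<lambda>i. a * u (A - {i}) + b * u (toggle (L i) (A - {i})) + c * u (toggle (R i) (A - {i}))
        + d * u (toggle (L i) (toggle (R i) (A - {i})))"
    let ?V = "\<bar>a\<bar> * v0 + (\<bar>b\<bar> + \<bar>c\<bar>) * v1 + \<bar>d\<bar> * v2"
    have t: "\<bar>?t i\<bar> \<le> ?V" if "i \<in> A" for i
    proof -
      have i: "L i \<in> S" "R i \<in> S" "A - {i} \<subseteq> S" using that A L R by auto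
      have cd: "Suc (card (A - {i})) = card A" using A(1) that by (rule card_Suc_Diff1)
      have s: "toggle (L i) (A - {i}) \<subseteq> S" "toggle (R i) (A - {i}) \<subseteq> S"
        "toggle (L i) (toggle (R i) (A - {i})) \<subseteq> S"
        by (intro toggle_subset i)+
      have k: "card (toggle (L i) (A - {i})) \<le> card A" "card (toggle (R i) (A - {i})) \<le> card A"
        using card_toggle_le[of "L i" "A - {i}"] card_toggle_le[of "R i" "A - {i}"] cd by auto
      have k2: "card (toggle (L i) (toggle (R i) (A - {i}))) \<le> Suc (card A)"
        using card_toggle_le[of "L i" "toggle (R i) (A - {i})"] k(2) by linarith
      have "\<bar>a * u (A - {i})\<bar> \<le> \<bar>a\<bar> * v0"
        unfolding abs_mult using A i cd by (intro mult_left_mono v) auto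
      moreover have "\<bar>b * u (toggle (L i) (A - {i}))\<bar> \<le> \<bar>b\<bar> * v1"
        unfolding abs_mult using A s k by (intro mult_left_mono v) auto
      moreover have "\<bar>c * u (toggle (R i) (A - {i}))\<bar> \<le> \<bar>c\<bar> * v1"
        unfolding abs_mult using A s k by (intro mult_left_mono v) auto
      moreover have "\<bar>d * u (toggle (L i) (toggle (R i) (A - {i})))\<bar> \<le> \<bar>d\<bar> * v2"
        unfolding abs_mult using A s k2 by (intro mult_left_mono v) auto
      moreover have "\<bar>x1 + x2 + x3 + x4\<bar> \<le> y1 + (y2 + y3) + y4"
        if "\<bar>x1\<bar> \<le> y1" "\<bar>x2\<bar> \<le> y2" "\<bar>x3\<bar> \<le> y3" "\<bar>x4\<bar> \<le> y4"
        for x1 x2 x3 x4 y1 y2 y3 y4 :: real using that by linarith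
      ultimately show ?thesis unfolding distrib_right by blast
    qed
    have "real (card A) * \<bar>u A\<bar> = \<bar>\<Sum>i\<in>A. ?t i\<bar>"
      unfolding eq[OF A(1,2), symmetric] by (simp add: abs_mult)
    also have "\<dots> \<le> (\<Sum>i\<in>A. \<bar>?t i\<bar>)" by (rule sum_abs)
    also have "\<dots> \<le> (\<Sum>i\<in>A. ?V)" by (intro sum_mono t)
    also have "\<dots> = real (card A) * ?V" by simp
    finally show ?thesis using A by (simp add: card_gt_0_iff)
  qed
  define \<alpha> \<beta> \<gamma> where "\<alpha> = \<bar>a\<bar>" and "\<beta> = \<bar>b\<bar> + \<bar>c\<bar>" and "\<gamma> = \<bar>d\<bar>"
  note step' = step[folded \<alpha>_def \<beta>_def \<gamma>_def]
  have co: "\<alpha> + \<beta> + \<gamma> \<le> 1" "\<alpha> + \<beta> + \<gamma> < 1 \<or> (0 < \<alpha> \<and> \<gamma> \<le> \<alpha>)"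
    using coeffs unfolding \<alpha>_def \<beta>_def \<gamma>_def by (simp_all only: add.assoc)
  have nonneg: "0 \<le> \<alpha>" "0 \<le> \<beta>" "0 \<le> \<gamma>"
    by (simp_all add: \<alpha>_def \<beta>_def \<gamma>_def)
  have K: "0 \<le> K" using bound[of "{}"] by linarith
  from co(2) show ?thesis
  proof
    assume lt: "\<alpha> + \<beta> + \<gamma> < 1"
    let ?s = "\<alpha> + \<beta> + \<gamma>"
    have pow: "\<forall>A. finite A \<longrightarrow> A \<subseteq> S \<longrightarrow> \<bar>u A\<bar> \<le> ?s ^ n * K" for n
    proof (induction n)
      case 0
      then show ?case using bound by simp
    next
      case (Suc n)
      show ?case
      proof (intro allI impI)
        fix A assume A: "finite A" "A \<subseteq> S"
        show "\<bar>u A\<bar> \<le> ?s ^ Suc n * K"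
        proof (cases "A = {}")
          case True
          then show ?thesis using assms(1) K nonneg by (simp add: zero_le_mult_iff)
        next
          case False
          have "\<bar>u A\<bar> \<le> \<alpha> * (?s ^ n * K) + \<beta> * (?s ^ n * K) + \<gamma> * (?s ^ n * K)"
            using Suc by (intro step' A False) auto
          also have "\<dots> = ?s ^ Suc n * K" by (simp add: algebra_simps)
          finally show ?thesis .
        qed
      qed
    qed
    have "(\<lambda>n. ?s ^ n * K) \<longlonglongrightarrow> 0 * K"
      using lt nonneg by (intro tendsto_mult_right LIMSEQ_realpow_zero) auto
    moreover have "\<bar>u A\<bar> \<le> ?s ^ n * K" for n
      using pow[of n] assms(8,9) by blast
    ultimately have "\<bar>u A\<bar> \<le> 0 * K"
      by (intro LIMSEQ_le_const) auto
    then show ?thesis by simp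
  next
    assume crit: "0 < \<alpha> \<and> \<gamma> \<le> \<alpha>"
    \<comment> \<open>\<open>w n\<close> is the maximum of \<open>\<bar>u\<bar>\<close> over the sets with at most \<open>n\<close> elements; \<open>conv\<close> is its convexity.\<close>
    define T where "T = (\<lambda>n. {\<bar>u A\<bar> | A. finite A \<and> A \<subseteq> S \<and> card A \<le> n})"
    define w where "w = (\<lambda>n. Sup (T n))"
    have bdd: "bdd_above (T n)" for n
      using bound by (intro bdd_aboveI[of _ K]) (auto simp: T_def)
    have ne: "T n \<noteq> {}" for n
      by (auto simp: T_def intro!: exI[of _ "{}"])
    have le_w: "\<bar>u A\<bar> \<le> w n" if "finite A" "A \<subseteq> S" "card A \<le> n" for A n
      unfolding w_def using that by (intro cSup_upper bdd) (auto simp: T_def)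
    have w_le: "w n \<le> v" if "\<And>A. finite A \<Longrightarrow> A \<subseteq> S \<Longrightarrow> card A \<le> n \<Longrightarrow> \<bar>u A\<bar> \<le> v" for n v
      unfolding w_def using that by (intro cSup_least ne) (auto simp: T_def)
    have w_mono: "w m \<le> w n" if "m \<le> n" for m n
      using that by (intro w_le le_w) auto
    have w0: "w 0 = 0"
    proof (rule antisym)
      show "w 0 \<le> 0" using assms(1) by (intro w_le) auto
      show "0 \<le> w 0" using le_w[of "{}" 0] by simp
    qed
    have w_nonneg: "0 \<le> w n" for n using w_mono[of 0 n] w0 by simp
    have w_K: "w n \<le> K" for n by (intro w_le bound)
    have conv: "w (Suc n) - w n \<le> w (Suc (Suc n)) - w (Suc n)" for n
    proof -
      let ?V = "\<alpha> * w n + \<beta> * w (Suc n) + \<gamma> * w (Suc (Suc n))"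
      have "w (Suc n) \<le> ?V"
      proof (rule w_le)
        fix A assume A: "finite A" "A \<subseteq> S" "card A \<le> Suc n"
        show "\<bar>u A\<bar> \<le> ?V"
        proof (cases "A = {}")
          case True
          then show ?thesis using assms(1) w_nonneg nonneg by simp
        next
          case False
          then show ?thesis using A by (intro step' le_w) auto
        qed
      qed
      moreover have "(\<alpha> + \<gamma>) * w (Suc n) \<le> (1 - \<beta>) * w (Suc n)"
        using co(1) w_nonneg by (intro mult_right_mono) auto
      ultimately have "\<alpha> * (w (Suc n) - w n) \<le> \<gamma> * (w (Suc (Suc n)) - w (Suc n))"
        by (simp add: algebra_simps)
      also have "\<dots> \<le> \<alpha> * (w (Suc (Suc n)) - w (Suc n))"
        using crit w_mono[of "Suc n" "Suc (Suc n)"] by (intro mult_right_mono) auto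
      finally show ?thesis using crit by simp
    qed
    have inc: "w (Suc n) - w n \<le> w (Suc (n + m)) - w (n + m)" for n m
    proof (induction m)
      case (Suc m)
      then show ?case using conv[of "n + m"] by simp
    qed simp
    \<comment> \<open>A positive increment would persist and force \<open>w\<close> to grow linearly, against the bound \<open>K\<close>.\<close>
    have grow: "real m * (w (Suc n) - w n) \<le> w (n + m) - w n" for n m
    proof (induction m)
      case (Suc m)
      then show ?case using inc[of n m] by (simp add: algebra_simps)
    qed simp
    have "w (Suc n) - w n \<le> 0" for n
    proof (rule ccontr)
      assume "\<not> ?thesis"
      then obtain m where "K < real m * (w (Suc n) - w n)"
        using reals_Archimedean3[of "w (Suc n) - w n"] by auto
      with grow[of m n] w_K[of "n + m"] w_nonneg[of n] show False by linarith
    qed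
    then have "w n \<le> 0" for n
    proof (induction n)
      case (Suc n)
      then show ?case by (smt (verit))
    qed (simp add: w0)
    with le_w[OF assms(8,9) order_refl] have "\<bar>u A\<bar> \<le> 0" by (meson order_trans)
    then show ?thesis by simp
  qed
qed

text \<open>
  For parameters in \<open>[1/4, 3/4]\<close> the response \<open>2 p - 1\<close> takes values in \<open>[- 1/2, 1/2]\<close>. Among the linear
  forms \<open>\<plusminus> a \<plusminus> b \<plusminus> c \<plusminus> d\<close>, those with an even number of minus signs are values of the response up to sign,
  and each of the others is a sum of such values divided by two. A sum of absolute values equal to one
  therefore forces all four absolute values to be \<open>1/4\<close>; an example is half
  the sign of the conjunction of the two neighbouring statuses.
\<close>

lemma noisy_response_coefficients:
  assumes p: "\<And>m. m \<in> {0, 1, 2, 3} \<Longrightarrow> p m \<in> {1/4..3/4::real}"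
  obtains a b c d where
    "\<And>y z. 2 * p (nbr_code y z) - 1 = a + b * spin y + c * spin z + d * (spin y * spin z)"
    "\<bar>a\<bar> + \<bar>b\<bar> + \<bar>c\<bar> + \<bar>d\<bar> \<le> 1"
    "\<bar>a\<bar> + \<bar>b\<bar> + \<bar>c\<bar> + \<bar>d\<bar> < 1 \<or> (0 < \<bar>a\<bar> \<and> \<bar>d\<bar> \<le> \<bar>a\<bar>)"
proof -
  define h where "h = (\<lambda>m. 2 * p m - 1)"
  have "\<bar>h m\<bar> \<le> 1/2" if "m \<in> {0, 1, 2, 3}" for m
    using p[OF that] unfolding h_def atLeastAtMost_iff by linarith
  then have h: "\<bar>h 0\<bar> \<le> 1/2" "\<bar>h 1\<bar> \<le> 1/2" "\<bar>h 2\<bar> \<le> 1/2" "\<bar>h 3\<bar> \<le> 1/2"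
    by auto
  define a b c d where "a = (h 0 + h 1 + h 2 + h 3) / 4" and "b = (h 2 + h 3 - h 0 - h 1) / 4"
    and "c = (h 1 + h 3 - h 0 - h 2) / 4" and "d = (h 0 + h 3 - h 1 - h 2) / 4"
  note abcd = a_def b_def c_def d_def
  show ?thesis
  proof (rule that)
    show "2 * p (nbr_code y z) - 1 = a + b * spin y + c * spin z + d * (spin y * spin z)" for y z
      by (cases y; cases z)
         (simp_all add: abcd h_def nbr_code_def spin_def numeral_2_eq_2 numeral_3_eq_3 field_simps)
    have "a - b - c + d = h 0" "a - b + c - d = h 1" "a + b - c - d = h 2" "a + b + c + d = h 3"
      unfolding abcd by (simp_all add: field_simps)
    with h have bounds:
      "a - b - c + d \<le> 1/2" "- a + b + c - d \<le> 1/2" "a - b + c - d \<le> 1/2" "- a + b - c + d \<le> 1/2"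
      "a + b - c - d \<le> 1/2" "- a - b + c + d \<le> 1/2" "a + b + c + d \<le> 1/2" "- a - b - c - d \<le> 1/2"
      by (auto simp: abs_le_iff)
    show "\<bar>a\<bar> + \<bar>b\<bar> + \<bar>c\<bar> + \<bar>d\<bar> \<le> 1"
      using bounds by linarith
    show "\<bar>a\<bar> + \<bar>b\<bar> + \<bar>c\<bar> + \<bar>d\<bar> < 1 \<or> (0 < \<bar>a\<bar> \<and> \<bar>d\<bar> \<le> \<bar>a\<bar>)"
    proof (cases "\<bar>a\<bar> + \<bar>b\<bar> + \<bar>c\<bar> + \<bar>d\<bar> < 1")
      case False
      then have "1/4 \<le> \<bar>a\<bar>" "\<bar>d\<bar> \<le> 1/4"
        using bounds by linarith+
      then show ?thesis by linarith
    qed simp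
  qed
qed

text \<open>
  The moments of a functional that annihilates the generator on \<open>walsh A\<close> satisfy the dual equation.
\<close>

lemma walsh_balance:
  fixes E :: "(('i \<Rightarrow> bool) \<Rightarrow> real) \<Rightarrow> real"
  assumes "mean_functional E" "finite A"
    and expand: "\<And>y z. 2 * p (nbr_code y z) - 1 = a + b * spin y + c * spin z + d * (spin y * spin z)"
    and zero: "E (\<lambda>x. \<Sum>i\<in>A. flip_rate p (x i) (x (L i)) (x (R i)) * (walsh A (flip x i) - walsh A x)) = 0"
  shows "real (card A) * E (walsh A) =
    (\<Sum>i\<in>A. a * E (walsh (A - {i})) + b * E (walsh (toggle (L i) (A - {i})))
       + c * E (walsh (toggle (R i) (A - {i}))) + d * E (walsh (toggle (L i) (toggle (R i) (A - {i})))))"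
proof -
  interpret mean_functional E by (rule assms)
  define f where "f = (\<lambda>i x. a * walsh (A - {i}) x + b * walsh (toggle (L i) (A - {i})) x
    + c * walsh (toggle (R i) (A - {i})) x + d * walsh (toggle (L i) (toggle (R i) (A - {i}))) x)"
  note b = bounded_range_scale[OF bounded_walsh]
  have bf: "bounded (range (f i))" for i
    unfolding f_def by (intro bounded_plus_comp b)
  have Ef: "E (f i) = a * E (walsh (A - {i})) + b * E (walsh (toggle (L i) (A - {i})))
      + c * E (walsh (toggle (R i) (A - {i}))) + d * E (walsh (toggle (L i) (toggle (R i) (A - {i}))))" for i
    unfolding f_def by (simp add: mean_add bounded_plus_comp b mean_scale bounded_walsh)
  have "0 = E (\<lambda>x. \<Sum>i\<in>A. f i x - walsh A x)"
    unfolding zero[symmetric]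
    by (intro arg_cong[where f = E] ext sum.cong refl)
       (simp add: f_def walsh_flip_drift[OF \<open>finite A\<close> _ expand])
  also have "\<dots> = (\<Sum>i\<in>A. E (f i) - E (walsh A))"
    using \<open>finite A\<close> by (simp add: mean_sum bounded_minus_comp bf bounded_walsh mean_diff)
  also have "\<dots> = (\<Sum>i\<in>A. E (f i)) - real (card A) * E (walsh A)"
    by (simp add: sum_subtractf)
  finally show ?thesis by (simp add: Ef)
qed

text \<open>
  The neighbour maps \<open>L\<close> and \<open>R\<close> on the set \<open>S\<close> of sites are arbitrary, so that the statement covers both
  the cycle and the integers.
\<close>

lemma walsh_moments_unique:
  assumes "mean_functional \<Lambda>\<^sub>1" "mean_functional \<Lambda>\<^sub>2"
    and p: "\<And>m. m \<in> {0, 1, 2, 3} \<Longrightarrow> p m \<in> {1/4..3/4}"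
    and LR: "\<And>i. i \<in> S \<Longrightarrow> L i \<in> S" "\<And>i. i \<in> S \<Longrightarrow> R i \<in> S"
    and zero: "\<And>\<Lambda> A. \<Lambda> \<in> {\<Lambda>\<^sub>1, \<Lambda>\<^sub>2} \<Longrightarrow> finite A \<Longrightarrow> A \<subseteq> S \<Longrightarrow>
      \<Lambda> (\<lambda>x. \<Sum>i\<in>A. flip_rate p (x i) (x (L i)) (x (R i)) * (walsh A (flip x i) - walsh A x)) = 0"
    and A: "finite A" "A \<subseteq> S"
  shows "\<Lambda>\<^sub>1 (walsh A) = \<Lambda>\<^sub>2 (walsh A)"
proof -
  interpret M1: mean_functional \<Lambda>\<^sub>1 by (rule assms)
  interpret M2: mean_functional \<Lambda>\<^sub>2 by (rule assms)
  obtain a b c d where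
    expand: "\<And>y z. 2 * p (nbr_code y z) - 1 = a + b * spin y + c * spin z + d * (spin y * spin z)"
    and co: "\<bar>a\<bar> + \<bar>b\<bar> + \<bar>c\<bar> + \<bar>d\<bar> \<le> 1"
      "\<bar>a\<bar> + \<bar>b\<bar> + \<bar>c\<bar> + \<bar>d\<bar> < 1 \<or> (0 < \<bar>a\<bar> \<and> \<bar>d\<bar> \<le> \<bar>a\<bar>)"
    using noisy_response_coefficients[of p] p by metis
  let ?u = "\<lambda>A. \<Lambda>\<^sub>1 (walsh A) - \<Lambda>\<^sub>2 (walsh A)"
  have "?u A = 0"
  proof (rule dual_moments_vanish[OF _ _ LR _ co A])
    show "?u {} = 0" using M1.mean_one M2.mean_one by simp
    show "\<bar>?u A\<bar> \<le> 2" for A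
      using M1.mean_abs_le[of "walsh A" 1] M2.mean_abs_le[of "walsh A" 1] by (simp add: abs_walsh)
    show "real (card A) * ?u A =
      (\<Sum>i\<in>A. a * ?u (A - {i}) + b * ?u (toggle (L i) (A - {i})) + c * ?u (toggle (R i) (A - {i}))
        + d * ?u (toggle (L i) (toggle (R i) (A - {i}))))" if "finite A" "A \<subseteq> S" for A
      unfolding right_diff_distrib
        walsh_balance[where L = L and R = R and p = p, OF assms(1) that(1) expand zero[OF _ that, of \<Lambda>\<^sub>1, simplified]]
        walsh_balance[where L = L and R = R and p = p, OF assms(2) that(1) expand zero[OF _ that, of \<Lambda>\<^sub>2, simplified]]
      unfolding sum_subtractf[symmetric] by (intro sum.cong refl) simp
  qed
  then show ?thesis by simp
qed

text \<open>
  Fourier inversion on \<open>{0, 1}\<^sup>I\<close>: the moments of the Walsh functions determine point probabilities.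
\<close>

lemma walsh_orthogonality:
  assumes "finite I"
  shows "(\<Sum>A\<in>Pow I. walsh A z * walsh A x) = (if \<forall>i\<in>I. x i = z i then 2 ^ card I else 0)"
proof -
  have "(\<Sum>A\<in>Pow I. walsh A z * walsh A x) = (\<Sum>A\<in>Pow I. (\<Prod>i\<in>A. spin (z i) * spin (x i)) * (\<Prod>i\<in>I - A. 1))"
    by (simp add: walsh_def prod.distrib)
  also have "\<dots> = (\<Prod>i\<in>I. spin (z i) * spin (x i) + 1)"
    by (rule prod_add[OF assms, symmetric])
  also have "\<dots> = (\<Prod>i\<in>I. if x i = z i then 2 else 0)"
    by (intro prod.cong) (auto simp: spin_def)
  also have "\<dots> = (if \<forall>i\<in>I. x i = z i then 2 ^ card I else 0)"
  proof (cases "\<forall>i\<in>I. x i = z i")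
    case True
    then show ?thesis by simp
  next
    case False
    then show ?thesis using assms by (auto intro: prod_zero)
  qed
  finally show ?thesis .
qed

section \<open>Stationary distributions of the player chain\<close>

definition left_of :: "nat \<Rightarrow> nat \<Rightarrow> nat" where
  "left_of N i = (if i = 1 then N else i - 1)"

definition right_of :: "nat \<Rightarrow> nat \<Rightarrow> nat" where
  "right_of N i = (if i = N then 1 else i + 1)"

definition player_rate :: "(nat \<Rightarrow> real) \<Rightarrow> nat \<Rightarrow> (nat \<Rightarrow> bool) \<Rightarrow> nat \<Rightarrow> real" where
  "player_rate p N x i = flip_rate p (x i) (x (left_of N i)) (x (right_of N i))"

lemma player_code_eq: "player_code N x i = nbr_code (x (left_of N i)) (x (right_of N i))"
  by (simp add: player_code_def left_of_def right_of_def)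

lemma player_rate_eq:
  "player_rate p N x i = (if x i then 1 - p (player_code N x i) else p (player_code N x i))"
  by (simp add: player_rate_def player_code_eq flip_rate_def)

lemma finite_player_states [simp]: "finite (player_states N)"
  unfolding player_states_def by (intro finite_PiE) auto

lemma flip_player_states: "x \<in> player_states N \<Longrightarrow> i \<in> {1..N} \<Longrightarrow> flip x i \<in> player_states N"
  by (auto simp: player_states_def flip_def PiE_def extensional_def)

lemma flip_neq: "flip x i \<noteq> x"
  by (auto simp: flip_def fun_eq_iff)

text \<open>
  The transition matrix is the identity plus \<open>1 / N\<close> times the generator of flips at the rates
  \<open>player_rate\<close>; this is what links the discrete-time chain to the spin system.
\<close>

lemma player_trans_sum:
  assumes "x \<in> player_states N" "N \<ge> 1"
  shows "(\<Sum>y\<in>player_states N. player_trans p N x y * g y) =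
    g x + (\<Sum>i=1..N. player_rate p N x i * (g (flip x i) - g x)) / real N"
proof -
  let ?r = "player_rate p N x"
  have "(\<Sum>i=1..N. 1 - ?r i) = (\<Sum>i\<in>{1..N} \<inter> {i. \<not> x i}. 1 - ?r i) + (\<Sum>i\<in>{1..N} \<inter> - {i. \<not> x i}. 1 - ?r i)"
    by (rule sum.Int_Diff[of _ _ "{i. \<not> x i}", unfolded Diff_eq]) simp
  also have "{1..N} \<inter> {i. \<not> x i} = {i\<in>{1..N}. \<not> x i}" by auto
  also have "{1..N} \<inter> - {i. \<not> x i} = {i\<in>{1..N}. x i}" by auto
  finally have diag: "player_trans p N x x = (\<Sum>i=1..N. 1 - ?r i) / real N"
    by (simp add: player_trans_def player_rate_eq)
  have off: "player_trans p N x y = (\<Sum>i=1..N. if y = flip x i then ?r i / real N else 0)"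
    if "y \<noteq> x" for y
  proof -
    have "player_trans p N x y = (\<Sum>i\<in>{i\<in>{1..N}. y = flip x i}. ?r i / real N)"
      using that by (simp add: player_trans_def player_rate_eq)
    also have "\<dots> = (\<Sum>i=1..N. if y = flip x i then ?r i / real N else 0)"
      by (rule sum.inter_filter) simp
    finally show ?thesis .
  qed
  have "(\<Sum>y\<in>player_states N - {x}. player_trans p N x y * g y) =
      (\<Sum>y\<in>player_states N - {x}. \<Sum>i=1..N. (if y = flip x i then ?r i / real N * g y else 0))"
    by (intro sum.cong refl) (auto simp: off sum_distrib_right intro!: sum.cong)
  also have "\<dots> = (\<Sum>i=1..N. \<Sum>y\<in>player_states N - {x}. (if y = flip x i then ?r i / real N * g y else 0))"
    by (rule sum.swap)
  also have "\<dots> = (\<Sum>i=1..N. ?r i / real N * g (flip x i))"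
    using assms by (intro sum.cong refl) (simp add: sum.delta flip_player_states flip_neq)
  finally have "(\<Sum>y\<in>player_states N. player_trans p N x y * g y) =
      (\<Sum>i=1..N. 1 - ?r i) / real N * g x + (\<Sum>i=1..N. ?r i / real N * g (flip x i))"
    using assms(1) by (simp add: sum.remove[where x = x] diag)
  also have "(\<Sum>i=1..N. 1 - ?r i) / real N * g x = g x - (\<Sum>i=1..N. ?r i * g x) / real N"
    using assms(2) by (simp add: sum_subtractf diff_divide_distrib left_diff_distrib sum_distrib_right)
  finally show ?thesis
    by (simp add: right_diff_distrib sum_subtractf diff_divide_distrib sum_divide_distrib)
qed

lemma player_stationary_generator:
  assumes "player_stationary p N \<pi>" "N \<ge> 1"
  shows "(\<Sum>x\<in>player_states N. pmf \<pi> x * (\<Sum>i=1..N. player_rate p N x i * (g (flip x i) - g x))) = 0"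
proof -
  let ?S = "player_states N"
  have "(\<Sum>y\<in>?S. pmf \<pi> y * g y) = (\<Sum>y\<in>?S. \<Sum>x\<in>?S. pmf \<pi> x * (player_trans p N x y * g y))"
    using assms(1) unfolding player_stationary_def
    by (intro sum.cong refl) (simp add: sum_distrib_right[symmetric] mult.assoc[symmetric])
  also have "\<dots> = (\<Sum>x\<in>?S. pmf \<pi> x * (\<Sum>y\<in>?S. player_trans p N x y * g y))"
    unfolding sum_distrib_left by (rule sum.swap)
  also have "\<dots> = (\<Sum>x\<in>?S. pmf \<pi> x * g x + pmf \<pi> x * (\<Sum>i=1..N. player_rate p N x i * (g (flip x i) - g x)) / real N)"
    using assms(2) by (intro sum.cong refl) (simp add: player_trans_sum distrib_left)
  finally have "(\<Sum>x\<in>?S. pmf \<pi> x * (\<Sum>i=1..N. player_rate p N x i * (g (flip x i) - g x)) / real N) = 0"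
    by (simp add: sum.distrib)
  then show ?thesis using assms(2) by (simp add: sum_divide_distrib[symmetric])
qed

lemma mean_functional_finite:
  fixes w :: "'b \<Rightarrow> real" and e :: "'b \<Rightarrow> 'a"
  assumes "\<And>x. x \<in> S \<Longrightarrow> 0 \<le> w x" "(\<Sum>x\<in>S. w x) = 1"
  shows "mean_functional (\<lambda>f. \<Sum>x\<in>S. w x * f (e x))"
  using assms
  by unfold_locales (auto intro!: sum_nonneg simp: distrib_left sum.distrib sum_distrib_left mult.left_commute)

lemma sum_pmf_player_states: "player_dist N \<pi> \<Longrightarrow> (\<Sum>x\<in>player_states N. pmf \<pi> x) = 1"
  by (intro sum_pmf_eq_1) (auto simp: player_dist_def)

text \<open>
  Duality on the cycle determines all Walsh moments of a stationary distribution, and these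
  determine the distribution.
\<close>

lemma player_stationary_unique:
  assumes p: "\<And>m. m \<in> {0, 1, 2, 3} \<Longrightarrow> p m \<in> {1/4..3/4}" and "N \<ge> 1"
    and st: "player_stationary p N \<pi>" "player_stationary p N \<pi>'"
  shows "\<pi>' = \<pi>"
proof (rule pmf_eqI)
  fix z
  let ?S = "player_states N"
  let ?E = "\<lambda>\<pi> f. \<Sum>x\<in>?S. pmf \<pi> x * f x"
  have dist: "player_dist N \<pi>" "player_dist N \<pi>'"
    using st by (auto simp: player_stationary_def)
  have mean: "mean_functional (?E \<pi>)" if "player_dist N \<pi>" for \<pi>
    using mean_functional_finite[of ?S "pmf \<pi>" id] that by (simp add: sum_pmf_player_states)
  have gen: "?E \<pi> (\<lambda>x. \<Sum>i\<in>A. flip_rate p (x i) (x (left_of N i)) (x (right_of N i)) * (walsh A (flip x i) - walsh A x)) = 0"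
    if "player_stationary p N \<pi>" "A \<subseteq> {1..N}" for A \<pi>
  proof -
    have "(\<Sum>i=1..N. player_rate p N x i * (walsh A (flip x i) - walsh A x)) =
        (\<Sum>i\<in>A. player_rate p N x i * (walsh A (flip x i) - walsh A x))" for x
      using that(2) by (intro sum.mono_neutral_right) (auto simp: walsh_flip_outside)
    then show ?thesis
      using player_stationary_generator[OF that(1) \<open>N \<ge> 1\<close>, of "walsh A"] by (simp add: player_rate_def)
  qed
  have moments: "?E \<pi> (walsh A) = ?E \<pi>' (walsh A)" if "A \<subseteq> {1..N}" for A
  proof (rule walsh_moments_unique[where L = "left_of N" and R = "right_of N" and S = "{1..N}" and p = p])
    show "mean_functional (?E \<pi>)" "mean_functional (?E \<pi>')"
      by (intro mean dist)+
    show "p m \<in> {1/4..3/4}" if "m \<in> {0, 1, 2, 3}" for m using that by (rule p)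
    show "left_of N i \<in> {1..N}" "right_of N i \<in> {1..N}" if "i \<in> {1..N}" for i
      using that by (auto simp: left_of_def right_of_def)
    show "\<Lambda> (\<lambda>x. \<Sum>i\<in>A. flip_rate p (x i) (x (left_of N i)) (x (right_of N i)) * (walsh A (flip x i) - walsh A x)) = 0"
      if "\<Lambda> \<in> {?E \<pi>, ?E \<pi>'}" "A \<subseteq> {1..N}" for \<Lambda> A
      using that(1) gen[OF st(1) that(2)] gen[OF st(2) that(2)] by blast
    show "finite A" "A \<subseteq> {1..N}" using that by (auto intro: finite_subset)
  qed
  show "pmf \<pi>' z = pmf \<pi> z"
  proof (cases "z \<in> ?S")
    case False
    then have "z \<notin> set_pmf \<pi>" "z \<notin> set_pmf \<pi>'"
      using dist by (auto simp: player_dist_def)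
    then show ?thesis by (simp add: set_pmf_eq)
  next
    case True
    have inv: "2 ^ N * pmf \<pi> z = (\<Sum>A\<in>Pow {1..N}. walsh A z * ?E \<pi> (walsh A))" for \<pi>
    proof -
      have eq: "(\<forall>i\<in>{1..N}. x i = z i) \<longleftrightarrow> x = z" if "x \<in> ?S" for x
        using PiE_ext[OF that[unfolded player_states_def] True[unfolded player_states_def]] by blast
      have "(\<Sum>A\<in>Pow {1..N}. walsh A z * ?E \<pi> (walsh A)) =
          (\<Sum>A\<in>Pow {1..N}. \<Sum>x\<in>?S. pmf \<pi> x * (walsh A z * walsh A x))"
        by (simp add: sum_distrib_left mult.left_commute)
      also have "\<dots> = (\<Sum>x\<in>?S. pmf \<pi> x * (\<Sum>A\<in>Pow {1..N}. walsh A z * walsh A x))"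
        unfolding sum_distrib_left by (rule sum.swap)
      also have "\<dots> = (\<Sum>x\<in>?S. if x = z then pmf \<pi> x * 2 ^ N else 0)"
        unfolding walsh_orthogonality[OF finite_atLeastAtMost]
        by (intro sum.cong refl) (simp add: eq del: One_nat_def)
      finally show ?thesis using True by simp
    qed
    have "(2::real) ^ N * pmf \<pi>' z = 2 ^ N * pmf \<pi> z"
      unfolding inv by (intro sum.cong refl) (simp add: moments)
    then show ?thesis by simp
  qed
qed

lemma player_code_range: "player_code N x i \<in> {0, 1, 2, 3}"
  by (auto simp: player_code_def nbr_code_def)

text \<open>
  Krylov and Bogoliubov: start in any state, average the laws over the first \<open>n\<close> steps, and take a limit
  point. The average changes by \<open>O(1/n)\<close> under one more step, so the limit point is stationary.
\<close>

lemma player_stationary_exists: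
  assumes p: "\<And>m. m \<in> {0, 1, 2, 3} \<Longrightarrow> p m \<in> {0..1}" and "N \<ge> 1"
  shows "\<exists>\<pi>. player_stationary p N \<pi>"
proof -
  let ?S = "player_states N"
  define x0 where "x0 = (\<lambda>i\<in>{1..N}. False)"
  have x0: "x0 \<in> ?S" by (simp add: x0_def player_states_def)
  define law where "law = player_law p N (return_pmf x0)"
  have trans_nonneg: "0 \<le> player_trans p N x y" for x y
    using p[OF player_code_range] unfolding player_trans_def
    by (auto intro!: divide_nonneg_nonneg add_nonneg_nonneg sum_nonneg)
  \<comment> \<open>\<open>D n\<close> is the expectation at time \<open>n\<close> and \<open>U\<close> the one-step averaging operator; cutting \<open>U f\<close> off outside
    the finite state space makes it bounded.\<close>
  define D where "D = (\<lambda>n f. \<Sum>x\<in>?S. law n x * f x)"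
  define U where "U = (\<lambda>f x. if x \<in> ?S then \<Sum>y\<in>?S. player_trans p N x y * f y else 0)"
  have bounded_S: "bounded (range f)" if "\<And>x. x \<notin> ?S \<Longrightarrow> f x = 0" for f :: "_ \<Rightarrow> real"
  proof -
    have "range f \<subseteq> insert 0 (f ` ?S)" using that by auto
    then show ?thesis by (rule bounded_subset[rotated]) (simp add: finite_imp_bounded)
  qed
  have bounded_U: "bounded (range (U f))" for f
    by (rule bounded_S) (simp add: U_def)
  have D_Suc: "D (Suc n) f = D n (U f)" for n f
  proof -
    have "D (Suc n) f = (\<Sum>y\<in>?S. \<Sum>x\<in>?S. law n x * (player_trans p N x y * f y))"
      by (simp add: D_def law_def sum_distrib_right mult.assoc)
    also have "\<dots> = (\<Sum>x\<in>?S. law n x * (\<Sum>y\<in>?S. player_trans p N x y * f y))"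
      unfolding sum_distrib_left by (rule sum.swap)
    finally show ?thesis by (simp add: D_def U_def)
  qed
  have law_nonneg: "0 \<le> law n x" for n x
    by (induction n arbitrary: x) (auto simp: law_def intro!: sum_nonneg mult_nonneg_nonneg trans_nonneg)
  have law_sum: "(\<Sum>x\<in>?S. law n x) = 1" for n
  proof (induction n)
    case 0
    have "set_pmf (return_pmf x0) \<subseteq> ?S" using x0 by simp
    then show ?case unfolding law_def player_law.simps by (rule sum_pmf_eq_1[OF finite_player_states])
  next
    case (Suc n)
    have "D (Suc n) (\<lambda>_. 1) = D n (\<lambda>_. 1)"
      unfolding D_Suc using player_trans_sum[OF _ \<open>N \<ge> 1\<close>, of _ p "\<lambda>_. 1"]
      by (simp add: D_def U_def)
    then show ?case using Suc by (simp add: D_def)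
  qed
  have D_mean: "mean_functional (D n)" for n
    unfolding D_def using mean_functional_finite[of ?S "law n" id] by (simp add: law_nonneg law_sum)
  define E where "E = (\<lambda>n f. \<Sum>k\<in>{..n}. 1 / real (Suc n) * D k f)"
  have E_mean: "mean_functional (E n)" for n
  proof -
    interpret mean_functional "D k" for k by (rule D_mean)
    show ?thesis
      unfolding E_def
      by unfold_locales
        (auto intro!: sum_nonneg divide_nonneg_nonneg mean_nonneg simp: mean_one mean_add mean_scale sum.distrib distrib_left sum_distrib_left mult.left_commute
              simp del: of_nat_Suc)
  qed
  obtain \<Lambda> G where G: "G \<noteq> bot" "G \<le> sequentially" "mean_functional \<Lambda>"
    and lim: "\<And>f. bounded (range f) \<Longrightarrow> ((\<lambda>n. E n f) \<longlongrightarrow> \<Lambda> f) G"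
    using mean_functional_cluster[of sequentially E] E_mean by auto
  interpret mean_functional \<Lambda> by (rule G)
  have inv: "\<Lambda> (U f) = \<Lambda> f" if f: "bounded (range f)" for f
  proof -
    have "(\<Sum>k\<le>n. D (Suc k) f) - (\<Sum>k\<le>n. D k f) = D (Suc n) f - D 0 f" for n
      by (induction n) auto
    then have diff: "E n (U f) - E n f = (D (Suc n) f - D 0 f) / real (Suc n)" for n
      by (simp add: E_def D_Suc[symmetric] sum_divide_distrib[symmetric] diff_divide_distrib[symmetric] del: of_nat_Suc)
    obtain B where B: "\<And>x. \<bar>f x\<bar> \<le> B" using f by (auto simp: bounded_iff)
    have DB: "\<bar>D k f\<bar> \<le> B" for k
      by (rule mean_functional.mean_abs_le[OF D_mean B])
    have "\<bar>D (Suc n) f - D 0 f\<bar> \<le> 2 * B" for n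
      using DB[of "Suc n"] DB[of 0] by linarith
    then have le: "norm (E n (U f) - E n f) \<le> 2 * B / real (Suc n)" for n
      unfolding diff by (simp add: divide_right_mono del: of_nat_Suc)
    have lim0: "(\<lambda>n. 2 * B / real (Suc n)) \<longlonglongrightarrow> 0"
      by (rule LIMSEQ_Suc[OF lim_const_over_n])
    have "(\<lambda>n. E n (U f) - E n f) \<longlonglongrightarrow> 0"
      by (rule Lim_null_comparison[OF _ lim0]) (simp only: le eventually_True)
    then have "((\<lambda>n. E n (U f) - E n f) \<longlongrightarrow> 0) G"
      by (rule tendsto_mono[OF G(2)])
    with tendsto_diff[OF lim[OF bounded_U] lim[OF f]] have "\<Lambda> (U f) - \<Lambda> f = 0"
      by (rule tendsto_unique[OF G(1)])
    then show ?thesis by simp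
  qed
  define w where "w = (\<lambda>x. if x \<in> ?S then \<Lambda> (indicator {x}) else 0)"
  have w_nonneg: "0 \<le> w x" for x
    by (auto simp: w_def intro!: mean_nonneg bounded_indicator)
  have "E n (\<lambda>x. \<Sum>z\<in>?S. indicator {z} x) = E n (\<lambda>_. 1)" for n
    unfolding E_def D_def by (intro sum.cong refl arg_cong2[where f = "(*)"]) (simp add: indicator_def)
  then have "E n (\<lambda>x. \<Sum>z\<in>?S. indicator {z} x) = 1" for n
    using mean_functional.mean_one[OF E_mean] by simp
  then have "\<Lambda> (\<lambda>x. \<Sum>z\<in>?S. indicator {z} x) = 1"
    by (intro tendsto_unique[OF G(1) lim[OF bounded_range_sum[OF finite_player_states bounded_indicator]]]) simp
  then have w_sum: "(\<Sum>x\<in>?S. w x) = 1"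
    by (simp add: mean_sum bounded_indicator w_def)
  have w_inv: "(\<Sum>x\<in>?S. w x * player_trans p N x y) = w y" if "y \<in> ?S" for y
  proof -
    have U: "U (indicator {y}) = (\<lambda>x. \<Sum>z\<in>?S. player_trans p N z y * indicator {z} x)"
    proof
      fix x
      have "(\<Sum>z\<in>?S. player_trans p N x z * indicator {y} z) = player_trans p N x y"
        using that by (simp add: indicator_def if_distrib cong: if_cong)
      moreover have "(\<Sum>z\<in>?S. player_trans p N z y * indicator {z} x) = (if x \<in> ?S then player_trans p N x y else 0)"
        by (simp add: indicator_def if_distrib cong: if_cong)
      ultimately show "U (indicator {y}) x = (\<Sum>z\<in>?S. player_trans p N z y * indicator {z} x)"
        by (simp add: U_def)
    qed
    have "w y = \<Lambda> (U (indicator {y}))"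
      using inv[OF bounded_indicator, of "{y}"] that by (simp add: w_def)
    also have "\<dots> = (\<Sum>z\<in>?S. player_trans p N z y * \<Lambda> (indicator {z}))"
      unfolding U by (subst mean_sum) (simp_all only: finite_player_states bounded_range_scale bounded_indicator mean_scale)
    finally show ?thesis by (simp add: w_def mult.commute)
  qed
  have "(\<integral>\<^sup>+x. ennreal (w x) \<partial>count_space UNIV) = (\<Sum>x\<in>?S. ennreal (w x))"
    by (rule nn_integral_count_space') (auto simp: w_def)
  then have w_int: "(\<integral>\<^sup>+x. ennreal (w x) \<partial>count_space UNIV) = 1"
    using w_nonneg w_sum by (simp add: sum_ennreal)
  have pmf: "pmf (embed_pmf w) x = w x" for x
    by (rule pmf_embed_pmf[OF w_nonneg w_int])
  have "player_stationary p N (embed_pmf w)"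
    unfolding player_stationary_def player_dist_def
    using w_inv by (auto simp: pmf set_embed_pmf[OF w_nonneg w_int] w_def[THEN fun_cong] split: if_splits)
  then show ?thesis by blast
qed

section \<open>From the cycle to the integers\<close>

text \<open>
  The player found at site \<open>j\<close> when the cycle \<open>1, ..., N\<close> is wound around the integers with player \<open>r\<close> at
  the origin. The shift by one accounts for players being numbered from \<open>1\<close>.
\<close>

definition wrap :: "nat \<Rightarrow> nat \<Rightarrow> int \<Rightarrow> nat" where
  "wrap N r j = nat ((j + int r - 1) mod int N) + 1"

definition unroll :: "nat \<Rightarrow> (nat \<Rightarrow> bool) \<Rightarrow> nat \<Rightarrow> config" where
  "unroll N x r = (\<lambda>j. x (wrap N r j))"

lemma wrap_range: "N \<ge> 1 \<Longrightarrow> wrap N r j \<in> {1..N}"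
  by (auto simp: wrap_def nat_less_iff Suc_le_eq)

lemma wrap_0: "r \<in> {1..N} \<Longrightarrow> wrap N r 0 = r"
  by (auto simp: wrap_def)

lemma wrap_right:
  assumes "N \<ge> 1"
  shows "wrap N r (j + 1) = right_of N (wrap N r j)"
proof -
  define m where "m = (j + int r - 1) mod int N"
  have m: "0 \<le> m" "m < int N" using assms by (simp_all add: m_def)
  have "(j + 1 + int r - 1) mod int N = (m + 1) mod int N"
    unfolding m_def mod_add_left_eq by (simp add: algebra_simps)
  also have "\<dots> = (if m + 1 = int N then 0 else m + 1)"
    using m by auto
  finally show ?thesis
    using m unfolding wrap_def right_of_def m_def[symmetric] by (auto simp: nat_add_distrib)
qed

lemma wrap_left:
  assumes "N \<ge> 1"
  shows "wrap N r (j - 1) = left_of N (wrap N r j)"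
proof -
  have "wrap N r j = right_of N (wrap N r (j - 1))"
    using wrap_right[OF assms, of r "j - 1"] by simp
  then show ?thesis
    using wrap_range[OF assms, of r "j - 1"] by (auto simp: left_of_def right_of_def split: if_splits)
qed

lemma wrap_inj:
  assumes "wrap N r j = wrap N r j'" "\<bar>j - j'\<bar> < int N"
  shows "j = j'"
proof -
  have N: "0 < int N" using assms(2) by linarith
  have "(j + int r - 1) mod int N = (j' + int r - 1) mod int N"
    using assms(1) N by (simp add: wrap_def eq_nat_nat_iff)
  then have "int N dvd (j + int r - 1) - (j' + int r - 1)"
    by (simp add: mod_eq_dvd_iff)
  then have "int N dvd j - j'" by simp
  then show ?thesis using assms(2) by (metis dvd_imp_le_int eq_iff_diff_eq_0 abs_of_nat not_less)
qed

text \<open>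
  Because of the average over the player \<open>r\<close> at the origin, the identity with the mean profit is a
  rearrangement of sums, without appeal to rotation invariance of \<open>\<pi>\<close>.
\<close>

definition profile_mean :: "nat \<Rightarrow> (nat \<Rightarrow> bool) pmf \<Rightarrow> (config \<Rightarrow> real) \<Rightarrow> real" where
  "profile_mean N \<pi> f =
     (\<Sum>(x, r)\<in>player_states N \<times> {1..N}. pmf \<pi> x / real N * f (unroll N x r))"

lemma profile_mean_iterated:
  "profile_mean N \<pi> f = (\<Sum>r=1..N. \<Sum>x\<in>player_states N. pmf \<pi> x * f (unroll N x r)) / real N"
  unfolding profile_mean_def sum_divide_distrib
  by (subst sum.swap) (simp add: sum.cartesian_product)

lemma mean_functional_profile:
  assumes "player_dist N \<pi>" "N \<ge> 1"
  shows "mean_functional (profile_mean N \<pi>)"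
proof -
  let ?S = "player_states N \<times> {1..N}"
  have "(\<Sum>(x, r)\<in>?S. pmf \<pi> x / real N) = (\<Sum>x\<in>player_states N. \<Sum>r=1..N. pmf \<pi> x / real N)"
    by (rule sum.cartesian_product[symmetric])
  also have "\<dots> = 1"
    using assms by (simp add: sum_pmf_player_states)
  finally have "mean_functional (\<lambda>f. \<Sum>s\<in>?S. (case s of (x, r) \<Rightarrow> pmf \<pi> x / real N) * f (case s of (x, r) \<Rightarrow> unroll N x r))"
    by (intro mean_functional_finite) auto
  then show ?thesis
    by (simp add: profile_mean_def[abs_def] case_prod_beta)
qed

lemma mean_profit_eq_profile_mean:
  assumes "player_stationary p N \<pi>" "\<And>\<pi>'. player_stationary p N \<pi>' \<Longrightarrow> \<pi>' = \<pi>" "N \<ge> 1"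
  shows "mean_profit N p = profile_mean N \<pi> (\<lambda>x. 2 * p (nbr_code (x (- 1)) (x 1)) - 1)"
proof -
  have the: "(THE \<pi>. player_stationary p N \<pi>) = \<pi>"
    using assms(1,2) by blast
  have code: "p (player_code N x r) - (1 - p (player_code N x r)) =
      2 * p (nbr_code (unroll N x r (- 1)) (unroll N x r 1)) - 1" if "r \<in> {1..N}" for x r
    using wrap_left[OF assms(3), of r 0] wrap_right[OF assms(3), of r 0] wrap_0[OF that]
    by (simp add: player_code_eq unroll_def)
  show ?thesis
    unfolding mean_profit_def the profile_mean_iterated
    by (subst sum.swap) (simp add: sum_distrib_left[symmetric] code del: One_nat_def)
qed

definition depends_on :: "int set \<Rightarrow> (config \<Rightarrow> real) \<Rightarrow> bool" where
  "depends_on J f \<longleftrightarrow> (\<forall>x y. (\<forall>j\<in>J. x j = y j) \<longrightarrow> f x = f y)"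

lemma depends_onD: "depends_on J f \<Longrightarrow> (\<And>j. j \<in> J \<Longrightarrow> x j = y j) \<Longrightarrow> f x = f y"
  by (simp add: depends_on_def)

lemma depends_on_flip_outside:
  assumes "depends_on J f" "i \<notin> J"
  shows "f (flip x i) = f x"
  by (rule depends_onD[OF assms(1)]) (use assms(2) in \<open>auto simp: flip_def\<close>)

text \<open>
  The generator of the spin system with the sum restricted to \<open>J\<close>; it is the full generator
  for functions that depend on the coordinates in \<open>J\<close> only (\<open>infsum_spin_generator\<close>).
\<close>

definition spin_generator :: "(nat \<Rightarrow> real) \<Rightarrow> int set \<Rightarrow> (config \<Rightarrow> real) \<Rightarrow> config \<Rightarrow> real" where
  "spin_generator p J f x = (\<Sum>j\<in>J. spin_rate p x j * (f (flip x j) - f x))"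

lemma spin_rate_eq: "spin_rate p x i = flip_rate p (x i) (x (i - 1)) (x (i + 1))"
  by (simp add: spin_rate_def flip_rate_def)

lemma spin_rate_unroll:
  assumes "N \<ge> 1"
  shows "spin_rate p (unroll N x r) j = player_rate p N x (wrap N r j)"
  by (simp add: spin_rate_eq player_rate_def unroll_def wrap_left[OF assms] wrap_right[OF assms])

text \<open>
  Flipping player \<open>i\<close> on the cycle flips all sites of the unrolled configuration congruent to \<open>i\<close>. If \<open>N\<close>
  exceeds the diameter of \<open>J\<close>, at most one of them lies in \<open>J\<close>, and \<open>f\<close> cannot tell this from the flip of
  a single site. The rates agree exactly, also for sites at the border of \<open>J\<close>, because their
  neighbours are read off from the unrolled configuration.
\<close>

lemma profile_mean_generator:
  assumes st: "player_stationary p N \<pi>" and J: "finite J" "depends_on J f"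
    and N: "\<And>i j. i \<in> J \<Longrightarrow> j \<in> J \<Longrightarrow> \<bar>i - j\<bar> < int N" "N \<ge> 1"
  shows "profile_mean N \<pi> (spin_generator p J f) = 0"
proof -
  have "(\<Sum>x\<in>player_states N. pmf \<pi> x * spin_generator p J f (unroll N x r)) = 0" for r
  proof -
    let ?g = "\<lambda>x. f (unroll N x r)"
    let ?k = "wrap N r"
    have inj: "inj_on ?k J"
      by (rule inj_onI) (rule wrap_inj[OF _ N(1)])
    have inside: "f (flip (unroll N x r) j) = ?g (flip x (?k j))" if "j \<in> J" for x j
    proof -
      have "flip (unroll N x r) j i = unroll N (flip x (?k j)) r i" if "i \<in> J" for i
        using inj_onD[OF inj, of i j] that \<open>j \<in> J\<close> by (auto simp: flip_def unroll_def)
      then show ?thesis by (intro depends_onD[OF J(2)])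
    qed
    have outside: "?g (flip x i) = ?g x" if "i \<notin> ?k ` J" for x i
    proof -
      have "unroll N (flip x i) r j = unroll N x r j" if "j \<in> J" for j
        using that \<open>i \<notin> ?k ` J\<close> by (auto simp: flip_def unroll_def)
      then show ?thesis by (intro depends_onD[OF J(2)])
    qed
    have "spin_generator p J f (unroll N x r) =
        (\<Sum>i=1..N. player_rate p N x i * (?g (flip x i) - ?g x))" for x
    proof -
      have "spin_generator p J f (unroll N x r) =
          (\<Sum>j\<in>J. player_rate p N x (?k j) * (?g (flip x (?k j)) - ?g x))"
        unfolding spin_generator_def by (intro sum.cong refl) (simp add: spin_rate_unroll[OF N(2)] inside)
      also have "\<dots> = (\<Sum>i\<in>?k ` J. player_rate p N x i * (?g (flip x i) - ?g x))"
        by (simp add: sum.reindex[OF inj])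
      also have "\<dots> = (\<Sum>i=1..N. player_rate p N x i * (?g (flip x i) - ?g x))"
        using wrap_range[OF N(2), of r] by (intro sum.mono_neutral_left) (auto simp: outside)
      finally show ?thesis .
    qed
    then show ?thesis
      using player_stationary_generator[OF st N(2), of ?g] by simp
  qed
  then show ?thesis by (simp add: profile_mean_iterated)
qed

lemma profile_mean_generator_eventually:
  assumes st: "\<And>N. N \<ge> 3 \<Longrightarrow> player_stationary p N (\<pi> N)" and J: "finite J" "depends_on J f"
  shows "eventually (\<lambda>N. profile_mean N (\<pi> N) (spin_generator p J f) = 0) sequentially"
proof -
  obtain K where K: "\<And>j. j \<in> J \<Longrightarrow> \<bar>j\<bar> \<le> K"
    using bdd_above_finite[of "abs ` J"] J(1) by (auto simp: bdd_above_def)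
  show ?thesis
    using eventually_ge_at_top[of "max 3 (nat (2 * K + 1))"]
  proof eventually_elim
    case (elim N)
    show ?case
    proof (rule profile_mean_generator[OF st J])
      show "\<bar>i - j\<bar> < int N" if "i \<in> J" "j \<in> J" for i j
        using K[OF that(1)] K[OF that(2)] elim by linarith
    qed (use elim in auto)
  qed
qed

lemma depends_on_finite_range:
  assumes "finite J" "depends_on J f"
  shows "finite (range f)"
proof -
  have "f x = f (\<lambda>j. j \<in> J \<and> x j)" for x
    by (rule depends_onD[OF assms(2)]) simp
  then have "range f \<subseteq> (\<lambda>A. f (\<lambda>j. j \<in> A)) ` Pow J"
    by (auto intro!: image_eqI[where x = "{j \<in> J. _ j}"])
  then show ?thesis using assms(1) finite_surj[of "Pow J"] by blast
qed

lemma depends_on_bounded: "finite J \<Longrightarrow> depends_on J f \<Longrightarrow> bounded (range f)"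
  using depends_on_finite_range finite_imp_bounded by blast

lemma depends_on_spin_generator:
  assumes "depends_on J f"
  shows "depends_on (J \<union> (\<lambda>j. j - 1) ` J \<union> (\<lambda>j. j + 1) ` J) (spin_generator p J f)"
  unfolding depends_on_def
proof (intro allI impI)
  fix x y :: config
  assume *: "\<forall>j\<in>J \<union> (\<lambda>j. j - 1) ` J \<union> (\<lambda>j. j + 1) ` J. x j = y j"
  have "f x = f y" using * assms unfolding depends_on_def by blast
  moreover have "f (flip x j) = f (flip y j)" for j
  proof -
    have "\<forall>i\<in>J. flip x j i = flip y j i" using * by (auto simp: flip_def)
    then show ?thesis using assms unfolding depends_on_def by blast
  qed
  moreover have "spin_rate p x j = spin_rate p y j" if "j \<in> J" for j
    using * that by (simp add: spin_rate_eq)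
  ultimately show "spin_generator p J f x = spin_generator p J f y"
    unfolding spin_generator_def by (intro sum.cong) auto
qed

text \<open>
  The reduction of both parts of the theorem to a uniqueness statement about functionals on the
  configurations of the integers.
\<close>

lemma mean_profit_tendsto:
  assumes st: "\<And>N. N \<ge> 3 \<Longrightarrow> player_stationary p N (\<pi> N)"
    and unique: "\<And>N \<pi>'. N \<ge> 3 \<Longrightarrow> player_stationary p N \<pi>' \<Longrightarrow> \<pi>' = \<pi> N"
    and limit: "\<And>\<Lambda>. mean_functional \<Lambda> \<Longrightarrow>
      (\<And>J f. finite J \<Longrightarrow> depends_on J f \<Longrightarrow> \<Lambda> (spin_generator p J f) = 0) \<Longrightarrow>
      \<Lambda> (\<lambda>x. 2 * p (nbr_code (x (- 1)) (x 1)) - 1) = c"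
  shows "(\<lambda>N. mean_profit N p) \<longlonglongrightarrow> c"
proof -
  let ?\<phi> = "\<lambda>x::config. 2 * p (nbr_code (x (- 1)) (x 1)) - 1"
  have dep: "depends_on {- 1, 1} ?\<phi>" by (simp add: depends_on_def)
  have mean: "eventually (\<lambda>N. mean_functional (profile_mean N (\<pi> N))) sequentially"
    using eventually_ge_at_top[of 3]
    by eventually_elim (use st in \<open>auto intro!: mean_functional_profile simp: player_stationary_def\<close>)
  have "(\<lambda>N. profile_mean N (\<pi> N) ?\<phi>) \<longlonglongrightarrow> c"
  proof (rule mean_functional_tendsto[OF mean depends_on_bounded[OF _ dep]])
    fix \<Lambda> G
    assume G: "G \<noteq> bot" "G \<le> sequentially" "mean_functional \<Lambda>"
      and lim: "\<And>f. bounded (range f) \<Longrightarrow> ((\<lambda>N. profile_mean N (\<pi> N) f) \<longlongrightarrow> \<Lambda> f) G"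
    show "\<Lambda> ?\<phi> = c"
    proof (rule limit[OF G(3)])
      fix J f assume J: "finite J" "depends_on J f"
      have "((\<lambda>N. profile_mean N (\<pi> N) (spin_generator p J f)) \<longlongrightarrow> \<Lambda> (spin_generator p J f)) G"
        using J by (intro lim depends_on_bounded[OF _ depends_on_spin_generator]) auto
      moreover have "((\<lambda>N. profile_mean N (\<pi> N) (spin_generator p J f)) \<longlongrightarrow> 0) G"
        by (rule tendsto_eventually, rule filter_leD[OF G(2) profile_mean_generator_eventually[OF st J]])
      ultimately show "\<Lambda> (spin_generator p J f) = 0"
        by (rule tendsto_unique[OF G(1)])
    qed
  qed simp
  moreover have "eventually (\<lambda>N. profile_mean N (\<pi> N) ?\<phi> = mean_profit N p) sequentially"
    using eventually_ge_at_top[of 3]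
    by eventually_elim (simp add: mean_profit_eq_profile_mean[OF st unique])
  ultimately show ?thesis by (simp add: tendsto_cong)
qed

text \<open>
  The observed function is a combination of the constant and three Walsh functions, so uniqueness of
  the Walsh moments suffices.
\<close>

lemma convergent_mean_profit_noisy:
  assumes p: "\<And>m. m \<in> {0, 1, 2, 3} \<Longrightarrow> p m \<in> {1/4..3/4}"
  shows "convergent (\<lambda>N. mean_profit N p)"
proof -
  have p01: "p m \<in> {0..1}" if "m \<in> {0, 1, 2, 3}" for m using p[OF that] by auto
  have "\<forall>N. \<exists>\<pi>. N \<ge> 3 \<longrightarrow> player_stationary p N \<pi>"
    using player_stationary_exists[OF p01] by auto
  then obtain \<pi> where st: "\<And>N. N \<ge> 3 \<Longrightarrow> player_stationary p N (\<pi> N)" by metis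
  have unique: "\<pi>' = \<pi> N" if "N \<ge> 3" "player_stationary p N \<pi>'" for N \<pi>'
    using that st[OF that(1)] by (intro player_stationary_unique[OF p]) auto
  let ?inv = "\<lambda>\<Lambda>. mean_functional \<Lambda> \<and> (\<forall>J f. finite J \<longrightarrow> depends_on J f \<longrightarrow> \<Lambda> (spin_generator p J f) = 0)"
  let ?\<phi> = "\<lambda>x::config. 2 * p (nbr_code (x (- 1)) (x 1)) - 1"
  have dep: "depends_on A (walsh A)" for A
    by (auto simp: depends_on_def walsh_def)
  have same: "\<Lambda>\<^sub>1 (walsh A) = \<Lambda>\<^sub>2 (walsh A)" if "?inv \<Lambda>\<^sub>1" "?inv \<Lambda>\<^sub>2" "finite A" for \<Lambda>\<^sub>1 \<Lambda>\<^sub>2 A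
  proof (rule walsh_moments_unique[where L = "\<lambda>i. i - 1" and R = "\<lambda>i. i + 1" and S = UNIV and p = p])
    show "p m \<in> {1/4..3/4}" if "m \<in> {0, 1, 2, 3}" for m using that by (rule p)
    show "\<Lambda> (\<lambda>x. \<Sum>i\<in>A. flip_rate p (x i) (x (i - 1)) (x (i + 1)) * (walsh A (flip x i) - walsh A x)) = 0"
      if "\<Lambda> \<in> {\<Lambda>\<^sub>1, \<Lambda>\<^sub>2}" "finite A" for \<Lambda> A
    proof -
      have "\<Lambda> (spin_generator p A (walsh A)) = 0"
        using that \<open>?inv \<Lambda>\<^sub>1\<close> \<open>?inv \<Lambda>\<^sub>2\<close> dep by auto
      then show ?thesis by (simp add: spin_generator_def[abs_def] spin_rate_eq)
    qed
  qed (use that in auto)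
  obtain a b c d where
    expand: "\<And>y z. 2 * p (nbr_code y z) - 1 = a + b * spin y + c * spin z + d * (spin y * spin z)"
    using noisy_response_coefficients[of p] p by metis
  \<comment> \<open>The limit is the value at any invariant functional. The case distinction is only a device to name
    one: the profile means have a limit point, so it always exists.\<close>
  show ?thesis
  proof (cases "\<exists>\<Lambda>. ?inv \<Lambda>")
    case True
    then obtain \<Lambda>\<^sub>0 where \<Lambda>\<^sub>0: "?inv \<Lambda>\<^sub>0" by blast
    have phi: "\<Lambda> ?\<phi> = a + b * \<Lambda> (walsh {- 1}) + c * \<Lambda> (walsh {1}) + d * \<Lambda> (walsh {- 1, 1})"
      if "mean_functional \<Lambda>" for \<Lambda>
    proof -
      interpret mean_functional \<Lambda> by (rule that)
      have "?\<phi> = (\<lambda>x. a + b * walsh {- 1} x + c * walsh {1} x + d * walsh {- 1, 1} x)"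
        by (simp add: expand walsh_def)
      then show ?thesis
        by (simp add: mean_add mean_scale mean_const bounded_plus_comp bounded_range_scale bounded_walsh)
    qed
    have "(\<lambda>N. mean_profit N p) \<longlonglongrightarrow> \<Lambda>\<^sub>0 ?\<phi>"
    proof (rule mean_profit_tendsto[OF st unique])
      fix \<Lambda> assume "mean_functional \<Lambda>"
        "\<And>J f. finite J \<Longrightarrow> depends_on J f \<Longrightarrow> \<Lambda> (spin_generator p J f) = 0"
      then have "?inv \<Lambda>" by blast
      then show "\<Lambda> ?\<phi> = \<Lambda>\<^sub>0 ?\<phi>"
        using \<Lambda>\<^sub>0 same[of \<Lambda> \<Lambda>\<^sub>0] by (simp add: phi)
    qed auto
    then show ?thesis by (rule convergentI)
  next
    case False
    have "(\<lambda>N. mean_profit N p) \<longlonglongrightarrow> 0"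
      by (rule mean_profit_tendsto[OF st unique]) (use False in blast)+
    then show ?thesis by (rule convergentI)
  qed
qed

section \<open>Functionals and measures on the configurations of the integers\<close>

definition cylinder_sets :: "config set set" where
  "cylinder_sets = {A. \<exists>J. finite J \<and> depends_on J (indicator A)}"

lemma depends_on_indicator:
  "depends_on J (indicator A) \<longleftrightarrow> (\<forall>x y. (\<forall>j\<in>J. x j = y j) \<longrightarrow> x \<in> A \<longrightarrow> y \<in> A)"
proof
  assume *: "depends_on J (indicator A)"
  show "\<forall>x y. (\<forall>j\<in>J. x j = y j) \<longrightarrow> x \<in> A \<longrightarrow> y \<in> A"
  proof (intro allI impI)
    fix x y :: config assume "\<forall>j\<in>J. x j = y j" "x \<in> A"
    then have "indicator A y = (1::real)"
      using *[unfolded depends_on_def, rule_format, of x y] by simp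
    then show "y \<in> A" by (simp add: indicator_eq_1_iff)
  qed
next
  assume *: "\<forall>x y. (\<forall>j\<in>J. x j = y j) \<longrightarrow> x \<in> A \<longrightarrow> y \<in> A"
  show "depends_on J (indicator A)"
    unfolding depends_on_def
  proof (intro allI impI)
    fix x y :: config assume "\<forall>j\<in>J. x j = y j"
    then have "x \<in> A \<longleftrightarrow> y \<in> A"
      using *[rule_format, of x y] *[rule_format, of y x] by auto
    then show "indicator A x = (indicator A y :: real)" by (simp add: indicator_def)
  qed
qed

lemma cylinder_setsI:
  assumes "finite J" "\<forall>x y. (\<forall>j\<in>J. x j = y j) \<longrightarrow> x \<in> A \<longrightarrow> y \<in> A"
  shows "A \<in> cylinder_sets"
  unfolding cylinder_sets_def mem_Collect_eq depends_on_indicator using assms by blast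

lemma vimage_cylinder_set:
  assumes "finite J" "depends_on J f"
  shows "f -` B \<in> cylinder_sets"
proof (rule cylinder_setsI[OF assms(1)], intro allI impI)
  fix x y assume "\<forall>j\<in>J. x j = y j" "x \<in> f -` B"
  then show "y \<in> f -` B"
    using assms(2)[unfolded depends_on_def, rule_format, of x y] by simp
qed

lemma coordinates_cylinder_set: "finite J \<Longrightarrow> {y. \<forall>j\<in>J. y j = x j} \<in> cylinder_sets"
  by (rule cylinder_setsI[of J]) auto

lemma algebra_cylinder_sets: "algebra UNIV cylinder_sets"
  unfolding algebra_iff_Un
proof (intro conjI ballI)
  show "{} \<in> cylinder_sets"
    by (rule cylinder_setsI[of "{}"]) auto
  show "UNIV - A \<in> cylinder_sets" if "A \<in> cylinder_sets" for A
  proof -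
    obtain J where J: "finite J" "depends_on J (indicator A)"
      using \<open>A \<in> cylinder_sets\<close> unfolding cylinder_sets_def by blast
    have "(indicator A :: config \<Rightarrow> real) -` {0} \<in> cylinder_sets"
      by (rule vimage_cylinder_set[OF J])
    also have "(indicator A :: config \<Rightarrow> real) -` {0} = UNIV - A"
      by (auto simp: indicator_eq_0_iff)
    finally show ?thesis .
  qed
  show "A \<union> B \<in> cylinder_sets" if AB: "A \<in> cylinder_sets" "B \<in> cylinder_sets" for A B
  proof -
    obtain J K where "finite J" "depends_on J (indicator A)" "finite K" "depends_on K (indicator B)"
      using AB by (auto simp: cylinder_sets_def)
    then show ?thesis
      unfolding depends_on_indicator by (intro cylinder_setsI[of "J \<union> K"]) (simp, blast)
  qed
qed simp

lemma open_cylinder_set: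
  assumes "A \<in> cylinder_sets"
  shows "open A"
proof -
  obtain J where J: "finite J" "\<And>x y. (\<forall>j\<in>J. x j = y j) \<Longrightarrow> x \<in> A \<Longrightarrow> y \<in> A"
    using assms unfolding cylinder_sets_def depends_on_indicator by blast
  have "open ((\<lambda>y. y j) -` {b})" for j :: int and b :: bool
    by (intro open_vimage discrete_topology_class.open_discrete continuous_on_product_coordinates)
  then have "open (\<Inter>j\<in>J. (\<lambda>y. y j) -` {x j})" for x :: config
    using J(1) by blast
  then have "open (\<Union>x\<in>A. \<Inter>j\<in>J. (\<lambda>y. y j) -` {x j})"
    by blast
  also have "(\<Union>x\<in>A. \<Inter>j\<in>J. (\<lambda>y. y j) -` {x j}) = A"
  proof
    show "(\<Union>x\<in>A. \<Inter>j\<in>J. (\<lambda>y. y j) -` {x j}) \<subseteq> A"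
    proof
      fix y assume "y \<in> (\<Union>x\<in>A. \<Inter>j\<in>J. (\<lambda>y. y j) -` {x j})"
      then obtain x where "x \<in> A" "\<forall>j\<in>J. x j = y j" by auto
      then show "y \<in> A" using J(2) by blast
    qed
  qed auto
  finally show ?thesis .
qed

lemma closed_cylinder_set: "A \<in> cylinder_sets \<Longrightarrow> closed A"
  using algebra.compl_sets[OF algebra_cylinder_sets] open_cylinder_set
  by (auto simp: closed_def Compl_eq_Diff_UNIV)

lemma continuous_on_cylinder:
  assumes "finite J" "depends_on J f"
  shows "continuous_on UNIV f"
  using open_cylinder_set[OF vimage_cylinder_set[OF assms]]
  by (simp add: continuous_on_open_vimage)

text \<open>
  Every open set is a countable union of basic cylinder sets, because these are indexed by pairs of
  finite sets of integers.
\<close>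

lemma sigma_cylinder_sets: "sigma_sets UNIV cylinder_sets = sets borel"
proof
  show "sigma_sets UNIV cylinder_sets \<subseteq> sets borel"
    by (rule sets.sigma_sets_subset'[of _ borel, simplified]) (auto intro: borel_open open_cylinder_set)
  have "U \<in> sigma_sets UNIV cylinder_sets" if "open U" for U :: "config set"
  proof -
    note openU = that
    define b where "b = (\<lambda>(J, A). {y::config. \<forall>j\<in>J. y j \<longleftrightarrow> j \<in> A})"
    define I where "I = {(J, A). finite J \<and> finite A \<and> b (J, A) \<subseteq> U}"
    have "countable I"
    proof (rule countable_subset)
      show "I \<subseteq> Collect finite \<times> Collect finite" by (auto simp: I_def)
      show "countable (Collect finite \<times> Collect finite :: (int set \<times> int set) set)"
        by (intro countable_SIGMA countable_Collect_finite)
    qed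
    have "U = (\<Union>i\<in>I. b i)"
    proof
      show "U \<subseteq> (\<Union>i\<in>I. b i)"
      proof
        fix x assume "x \<in> U"
        obtain X where X: "x \<in> (\<Pi>\<^sub>E i\<in>UNIV. X i)" "finite {i. X i \<noteq> UNIV}" "(\<Pi>\<^sub>E i\<in>UNIV. X i) \<subseteq> U"
          using product_topology_open_contains_basis[of "\<lambda>_. euclidean" UNIV U x] openU \<open>x \<in> U\<close>
          by (auto simp: euclidean_product_topology)
        define J where "J = {i. X i \<noteq> UNIV}"
        have "b (J, {j\<in>J. x j}) \<subseteq> (\<Pi>\<^sub>E i\<in>UNIV. X i)"
        proof
          fix y assume y: "y \<in> b (J, {j\<in>J. x j})"
          have "y i \<in> X i" for i
          proof (cases "i \<in> J")
            case True
            then have "y i = x i" using y by (auto simp: b_def)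
            then show ?thesis using X(1) by auto
          qed (simp add: J_def)
          then show "y \<in> (\<Pi>\<^sub>E i\<in>UNIV. X i)" by auto
        qed
        then have "(J, {j\<in>J. x j}) \<in> I"
          using X unfolding I_def J_def by auto
        moreover have "x \<in> b (J, {j\<in>J. x j})" by (auto simp: b_def)
        ultimately show "x \<in> (\<Union>i\<in>I. b i)" by blast
      qed
    qed (auto simp: I_def)
    also have "(\<Union>i\<in>I. b i) \<in> sigma_sets UNIV cylinder_sets"
    proof -
      interpret sigma_algebra UNIV "sigma_sets UNIV cylinder_sets"
        by (rule sigma_algebra_sigma_sets) simp
      have "b i \<in> sigma_sets UNIV cylinder_sets" if "i \<in> I" for i
        using that coordinates_cylinder_set[of "fst i" "\<lambda>j. j \<in> snd i"]
        by (auto simp: b_def I_def)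
      then show ?thesis using \<open>countable I\<close> by (intro countable_UN') auto
    qed
    finally show ?thesis .
  qed
  then have "sigma_sets UNIV {U::config set. open U} \<subseteq> sigma_sets UNIV cylinder_sets"
    by (intro sigma_sets_mono) auto
  then show "sets borel \<subseteq> sigma_sets UNIV cylinder_sets"
    by (simp add: sets_borel)
qed

text \<open>
  Cylinder sets are closed in a compact space, which is the source of countable additivity.
\<close>

lemma decseq_cylinder_sets_empty:
  assumes "range A \<subseteq> cylinder_sets" "decseq A" "(\<Inter>i. A i) = {}"
  shows "\<exists>i. A i = {}"
proof (rule ccontr)
  assume ne: "\<nexists>i. A i = {}"
  have "compactin (product_topology (\<lambda>_::int. euclidean :: bool topology) UNIV) (PiE UNIV (\<lambda>_. UNIV))"
    by (subst compactin_PiE) (auto intro: finite_imp_compact)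
  then have "compact (UNIV :: config set)"
    by (simp add: euclidean_product_topology PiE_UNIV_domain)
  then have "UNIV \<inter> (\<Inter>i\<in>UNIV. A i) \<noteq> {}"
  proof (rule compact_imp_fip_image)
    show "closed (A i)" for i
      using assms(1) by (auto intro: closed_cylinder_set)
    fix I :: "nat set" assume "finite I"
    then have "A (Max (insert 0 I)) \<subseteq> (\<Inter>i\<in>I. A i)"
      using assms(2) by (intro INT_greatest) (auto simp: decseq_def)
    then show "UNIV \<inter> (\<Inter>i\<in>I. A i) \<noteq> {}" using ne by auto
  qed
  then show False using assms(3) by simp
qed

text \<open>
  The content \<open>A \<mapsto> \<Lambda> (indicator A)\<close> on cylinder sets extends to a measure by Caratheodory's theorem. A
  function of finitely many coordinates takes finitely many values, so its integral is a finite
  combination of measures of cylinder sets.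
\<close>

lemma mean_functional_measure:
  assumes "mean_functional \<Lambda>"
  shows "\<exists>\<pi>. config_dist \<pi> \<and>
    (\<forall>J f. finite J \<longrightarrow> depends_on J f \<longrightarrow> (LINT x|\<pi>. f x) = \<Lambda> f)"
proof -
  interpret mean_functional \<Lambda> by (rule assms)
  interpret A: algebra UNIV cylinder_sets by (rule algebra_cylinder_sets)
  have ind_nonneg: "0 \<le> \<Lambda> (indicator A)" for A
    by (intro mean_nonneg bounded_indicator) simp
  let ?f = "\<lambda>A. ennreal (\<Lambda> (indicator A))"
  have "\<exists>\<mu>. (\<forall>A\<in>cylinder_sets. \<mu> A = ?f A) \<and> measure_space UNIV (sigma_sets UNIV cylinder_sets) \<mu>"
  proof (rule A.caratheodory_empty_continuous)
    show "positive cylinder_sets ?f"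
      using mean_const[of 0] by (simp add: positive_def indicator_def[abs_def])
    show "additive cylinder_sets ?f"
      unfolding additive_def
    proof (intro ballI impI)
      fix A B :: "config set" assume "A \<inter> B = {}"
      then have "indicator (A \<union> B) = (\<lambda>x. indicator A x + indicator B x :: real)"
        by (auto simp: indicator_def fun_eq_iff)
      then have "\<Lambda> (indicator (A \<union> B)) = \<Lambda> (indicator A) + \<Lambda> (indicator B)"
        using mean_add[OF bounded_indicator bounded_indicator] by simp
      then show "?f (A \<union> B) = ?f A + ?f B" by (simp add: ind_nonneg)
    qed
    show "?f A \<noteq> \<infinity>" for A by simp
    show "(\<lambda>i. ?f (A i)) \<longlonglongrightarrow> 0"
      if A: "range A \<subseteq> cylinder_sets" "decseq A" "(\<Inter>i. A i) = {}" for A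
    proof -
      obtain k where k: "A k = {}" using decseq_cylinder_sets_empty[OF A] by blast
      have "A i = {}" if "i \<ge> k" for i using A(2) k that by (auto simp: decseq_def)
      then have "eventually (\<lambda>i. ?f (A i) = 0) sequentially"
        using mean_const[of 0] by (auto simp: eventually_sequentially indicator_def[abs_def] intro!: exI[of _ k])
      then show ?thesis by (rule tendsto_eventually)
    qed
  qed
  then obtain \<mu> where \<mu>: "\<And>A. A \<in> cylinder_sets \<Longrightarrow> \<mu> A = ?f A"
    and ms: "measure_space UNIV (sets (borel :: config measure)) \<mu>"
    by (auto simp: sigma_cylinder_sets)
  define \<pi> where "\<pi> = measure_of UNIV (sets (borel :: config measure)) \<mu>"
  have sets_\<pi>: "sets \<pi> = sets borel"
    by (simp add: \<pi>_def sets.sigma_sets_eq[of borel, simplified])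
  have space_\<pi>: "space \<pi> = UNIV" by (simp add: \<pi>_def)
  have em: "emeasure \<pi> A = ?f A" if "A \<in> cylinder_sets" for A
  proof -
    have "A \<in> sets borel" using that open_cylinder_set by auto
    then have "emeasure \<pi> A = \<mu> A"
      using ms unfolding \<pi>_def measure_space_def by (intro emeasure_measure_of_sigma) auto
    then show ?thesis using \<mu>[OF that] by simp
  qed
  have "emeasure \<pi> UNIV = 1"
    using em[of UNIV] A.top mean_one by (simp add: indicator_def[abs_def])
  then interpret \<pi>: prob_space \<pi> by (intro prob_spaceI) (simp add: space_\<pi>)
  have "(LINT x|\<pi>. f x) = \<Lambda> f" if f: "finite J" "depends_on J f" for J f
  proof -
    have fin: "finite (range f)" by (rule depends_on_finite_range[OF f])
    let ?A = "\<lambda>c. f -` {c}"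
    have expand: "f = (\<lambda>x. \<Sum>c\<in>range f. c * indicator (?A c) x)"
      by (rule ext) (simp add: indicator_def fin if_distrib cong: if_cong)
    have A: "?A c \<in> cylinder_sets" for c by (rule vimage_cylinder_set[OF f])
    have A': "?A c \<in> sets \<pi>" for c using A open_cylinder_set sets_\<pi> by auto
    have "measure \<pi> (?A c) = \<Lambda> (indicator (?A c))" for c
      by (simp add: measure_def em[OF A] ind_nonneg)
    moreover have "integrable \<pi> (indicator (?A c) :: _ \<Rightarrow> real)" for c
      using A' \<pi>.emeasure_finite by (intro integrable_real_indicator) (auto simp: less_top[symmetric])
    ultimately have "(LINT x|\<pi>. (\<Sum>c\<in>range f. c * indicator (?A c) x)) = (\<Sum>c\<in>range f. c * \<Lambda> (indicator (?A c)))"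
      by (subst Bochner_Integration.integral_sum) (simp_all add: space_\<pi>)
    also have "\<dots> = \<Lambda> (\<lambda>x. \<Sum>c\<in>range f. c * indicator (?A c) x)"
      using fin by (subst mean_sum) (simp_all only: mean_scale bounded_range_scale bounded_indicator)
    finally show ?thesis unfolding expand[symmetric] .
  qed
  moreover have "config_dist \<pi>"
    by (simp add: config_dist_def space_prob_algebra sets_\<pi> \<pi>.prob_space_axioms)
  ultimately show ?thesis by blast
qed

section \<open>Measures that annihilate the generator are stationary\<close>

lemma config_dist_integral:
  fixes f :: "config \<Rightarrow> real" and B :: real
  assumes "config_dist M" "continuous_on UNIV f" "\<And>x. \<bar>f x\<bar> \<le> B"
  shows "integrable M f" and "\<bar>LINT x|M. f x\<bar> \<le> B"
proof -
  interpret prob_space M using assms(1) by (simp add: config_dist_def space_prob_algebra)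
  have [measurable_cong]: "sets M = sets borel"
    using assms(1) by (simp add: config_dist_def space_prob_algebra)
  have [measurable]: "f \<in> borel_measurable borel"
    by (rule borel_measurable_continuous_onI[OF assms(2)])
  show int: "integrable M f"
    by (rule integrable_const_bound[of _ B]) (use assms(3) in auto)
  have "\<bar>LINT x|M. f x\<bar> \<le> (LINT x|M. \<bar>f x\<bar>)"
    by (rule integral_abs_bound)
  also have "\<dots> \<le> (LINT x|M. B)"
    by (rule integral_mono) (use int assms(3) in auto)
  finally show "\<bar>LINT x|M. f x\<bar> \<le> B" by (simp add: prob_space)
qed

lemma bcontfun_bound:
  fixes f :: "config \<Rightarrow>\<^sub>C real"
  shows "\<exists>B. \<forall>x. \<bar>f x\<bar> \<le> B"
  using bounded_apply_bcontfun[of f] by (auto simp: bounded_iff)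

lemma config_dist_integrable:
  fixes f :: "config \<Rightarrow>\<^sub>C real"
  assumes "config_dist M"
  shows "integrable M f"
  using bcontfun_bound[of f] config_dist_integral(1)[OF assms continuous_on_apply_bcontfun] by metis

lemma feller_config_dist:
  assumes "feller_transition P" "0 \<le> t"
  shows "config_dist (P t x)"
  using assms measurable_space[of "P t" borel "prob_algebra borel" x]
  by (auto simp: feller_transition_def config_dist_def)

lemma feller_integral_bind:
  fixes f :: "config \<Rightarrow>\<^sub>C real"
  assumes P: "feller_transition P" "0 \<le> t" and M: "config_dist M"
  shows "(LINT y|(M \<bind> P t). f y) = (LINT x|M. LINT y|P t x. f y)"
proof -
  obtain B where B: "\<And>x. \<bar>f x\<bar> \<le> B" using bcontfun_bound[of f] by blast
  have M': "prob_space M" "sets M = sets borel"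
    using M by (auto simp: config_dist_def space_prob_algebra)
  show ?thesis
  proof (rule integral_bind[where K = borel and B = B and B' = 1])
    show "apply_bcontfun f \<in> borel_measurable borel"
      by (rule borel_measurable_continuous_onI) simp
    have "P t \<in> borel \<rightarrow>\<^sub>M prob_algebra borel"
      using P by (auto simp: feller_transition_def)
    then show "P t \<in> M \<rightarrow>\<^sub>M subprob_algebra borel"
      using measurable_prob_algebraD measurable_cong_sets[OF M'(2) refl] by blast
    show "finite_measure M" using M'(1) by (rule prob_space.finite_measure)
    have "prob_space (P t x)" for x
      using feller_config_dist[OF P, of x] by (simp add: config_dist_def space_prob_algebra)
    then show "AE x in M. emeasure (P t x) (space (P t x)) \<le> ennreal 1"
      by (simp add: prob_space.emeasure_space_1)
  qed (use B in auto)
qed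

text \<open>
  The semigroup on continuous functions. By the Feller property and boundedness the function given to
  \<open>Bcontfun\<close> is bounded and continuous for every \<open>t \<ge> 0\<close>.
\<close>

definition semigroup_op ::
  "(real \<Rightarrow> config \<Rightarrow> config measure) \<Rightarrow> real \<Rightarrow> (config \<Rightarrow>\<^sub>C real) \<Rightarrow> (config \<Rightarrow>\<^sub>C real)" where
  "semigroup_op P t f = Bcontfun (\<lambda>x. LINT y|P t x. f y)"

lemma apply_semigroup_op:
  assumes "feller_transition P" "0 \<le> t"
  shows "apply_bcontfun (semigroup_op P t f) x = (LINT y|P t x. f y)"
proof -
  obtain B where B: "\<And>x. \<bar>f x\<bar> \<le> B" using bcontfun_bound[of f] by blast
  have "\<bar>LINT y|P t x. f y\<bar> \<le> B" for x
    by (rule config_dist_integral(2)[OF feller_config_dist[OF assms] continuous_on_apply_bcontfun B])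
  then have "(\<lambda>x. LINT y|P t x. f y) \<in> bcontfun"
    using assms by (auto simp: bcontfun_def feller_transition_def bounded_iff)
  then show ?thesis by (simp add: semigroup_op_def Bcontfun_inverse)
qed

lemma semigroup_op_commute:
  assumes P: "feller_transition P" "0 \<le> s" "0 \<le> t"
  shows "(LINT y|P s x. semigroup_op P t f y) = (LINT y|P t x. semigroup_op P s f y)"
proof -
  have "(LINT y|P s x. semigroup_op P t f y) = (LINT y|P (s + t) x. f y)" if "0 \<le> s" "0 \<le> t" for s t
  proof -
    have "P (s + t) x = P s x \<bind> P t" using P(1) that by (auto simp: feller_transition_def)
    then show ?thesis
      using feller_integral_bind[OF P(1) that(2) feller_config_dist[OF P(1) that(1)], where f = f]
      by (simp add: apply_semigroup_op[OF P(1) that(2)])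
  qed
  from this[OF P(2,3)] this[OF P(3,2)] show ?thesis by (simp add: add.commute)
qed

text \<open>
  The semigroup is a contraction and commutes with itself, so a first-order estimate for \<open>f\<close> with error
  \<open>e\<close> is inherited, with the same error, by \<open>semigroup_op P t f\<close> for every \<open>t\<close>.
\<close>

lemma semigroup_op_generator_increment:
  fixes f g :: "config \<Rightarrow>\<^sub>C real"
  assumes P: "feller_transition P" "0 \<le> s" "0 \<le> t"
    and e: "\<And>x. \<bar>semigroup_op P s f x - f x - s * g x\<bar> \<le> e"
  shows "\<bar>(LINT y|P s x. semigroup_op P t f y) - semigroup_op P t f x - s * semigroup_op P t g x\<bar> \<le> e"
proof -
  note D = feller_config_dist[OF P(1,3), of x]
  note int = config_dist_integrable[OF D]
  have "(LINT y|P s x. semigroup_op P t f y) - semigroup_op P t f x - s * semigroup_op P t g x =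
      (LINT y|P t x. semigroup_op P s f y) - (LINT y|P t x. f y) - s * (LINT y|P t x. g y)"
    unfolding semigroup_op_commute[OF P] unfolding apply_semigroup_op[OF P(1,3)] by (rule refl)
  also have "\<dots> = (LINT y|P t x. semigroup_op P s f y - f y - s * g y)"
    by (simp add: int)
  also have "\<bar>\<dots>\<bar> \<le> e"
    by (rule config_dist_integral(2)[OF D _ e]) (intro continuous_intros continuous_on_apply_bcontfun)
  finally show ?thesis .
qed

lemma generator_increment:
  assumes P: "feller_transition P" and fg: "(f, g) \<in> generator P" and "0 < e"
  obtains \<delta> where "0 < \<delta>"
    "\<And>s x. 0 < s \<Longrightarrow> s < \<delta> \<Longrightarrow> \<bar>semigroup_op P s f x - f x - s * g x\<bar> \<le> e * s"
proof -
  have "eventually (\<lambda>s. \<forall>x. dist (((LINT y|P s x. f y) - f x) / s) (g x) < e) (at_right 0)"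
    using fg \<open>0 < e\<close> by (simp add: generator_def uniform_limit_iff)
  then obtain \<delta> where \<delta>: "0 < \<delta>"
    "\<And>s x. 0 < s \<Longrightarrow> s < \<delta> \<Longrightarrow> dist (((LINT y|P s x. f y) - f x) / s) (g x) < e"
    by (auto simp: eventually_at_right_field)
  have "\<bar>semigroup_op P s f x - f x - s * g x\<bar> \<le> e * s" if s: "0 < s" "s < \<delta>" for s x
  proof -
    have "semigroup_op P s f x - f x - s * g x = s * (((LINT y|P s x. f y) - f x) / s - g x)"
      using s by (simp add: apply_semigroup_op[OF P] field_simps)
    moreover have "\<bar>((LINT y|P s x. f y) - f x) / s - g x\<bar> \<le> e"
      using \<delta>(2)[OF s, of x] by (simp add: dist_real_def)
    ultimately show ?thesis
      using s mult_left_mono[of "\<bar>((LINT y|P s x. f y) - f x) / s - g x\<bar>" e s] by (simp add: abs_mult mult.commute)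
  qed
  with \<delta>(1) show ?thesis by (rule that)
qed

lemma generator_semigroup_op:
  assumes P: "feller_transition P" and fg: "(f, g) \<in> generator P" and t: "0 \<le> t"
  shows "(semigroup_op P t f, semigroup_op P t g) \<in> generator P"
  unfolding generator_def mem_Collect_eq case_prod_conv uniform_limit_iff
proof (intro allI impI)
  fix e :: real assume "0 < e"
  then have "0 < e / 2" by simp
  from generator_increment[OF P fg this] obtain \<delta> where \<delta>: "0 < \<delta>"
    "\<And>s x. 0 < s \<Longrightarrow> s < \<delta> \<Longrightarrow> \<bar>semigroup_op P s f x - f x - s * g x\<bar> \<le> e / 2 * s" by blast
  let ?q = "\<lambda>s x. ((LINT y|P s x. semigroup_op P t f y) - semigroup_op P t f x) / s"
  have "dist (?q s x) (semigroup_op P t g x) < e" if s: "0 < s" "s < \<delta>" for s x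
  proof -
    have "?q s x - semigroup_op P t g x =
        ((LINT y|P s x. semigroup_op P t f y) - semigroup_op P t f x - s * semigroup_op P t g x) / s"
      using s by (simp add: field_simps)
    also have "\<bar>\<dots>\<bar> \<le> e / 2"
      using semigroup_op_generator_increment[OF P _ t \<delta>(2)[OF s], of x] s
      by (simp add: abs_divide pos_divide_le_eq)
    finally show ?thesis using \<open>0 < e\<close> by (simp add: dist_real_def)
  qed
  then show "eventually (\<lambda>s. \<forall>x\<in>UNIV. dist (?q s x) (semigroup_op P t g x) < e) (at_right 0)"
    using \<delta>(1) by (auto simp: eventually_at_right_field)
qed

text \<open>
  Let \<open>F t\<close> be the integral of \<open>semigroup_op P t f\<close>. The generator term of its increments integrates to
  zero, and the error in the definition of the generator is uniform in \<open>t\<close>, so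
  \<open>\<bar>F (t + s) - F t\<bar> \<le> e * s\<close> for all \<open>t\<close> once \<open>s\<close> is small. Summing over \<open>n\<close> steps of length
  \<open>t / n\<close> gives \<open>\<bar>F t - F 0\<bar> \<le> e * t\<close> for every \<open>e > 0\<close>.
\<close>

lemma integral_semigroup_op_invariant:
  assumes P: "feller_transition P" and \<pi>: "config_dist \<pi>"
    and null: "\<And>f g. (f, g) \<in> generator P \<Longrightarrow> (LINT x|\<pi>. g x) = 0"
    and fg: "(f, g) \<in> generator P" and t: "0 \<le> t"
  shows "(LINT x|\<pi>. LINT y|P t x. f y) = (LINT x|\<pi>. f x)"
proof -
  note int = config_dist_integrable[OF \<pi>]
  define F where "F = (\<lambda>t. LINT x|\<pi>. semigroup_op P t f x)"
  have F_step: "\<bar>F (t + s) - F t\<bar> \<le> e"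
    if e: "\<And>x. \<bar>semigroup_op P s f x - f x - s * g x\<bar> \<le> e" and st: "0 \<le> s" "0 \<le> t" for s t e
  proof -
    have "(LINT y|P s x. semigroup_op P t f y) = semigroup_op P (t + s) f x" for x
    proof -
      have "P (s + t) x = P s x \<bind> P t" using P st by (auto simp: feller_transition_def)
      then show ?thesis
        using feller_integral_bind[OF P st(2) feller_config_dist[OF P st(1)], where f = f] st
        by (simp add: apply_semigroup_op[OF P] add.commute)
    qed
    with semigroup_op_generator_increment[OF P st e]
    have "\<bar>semigroup_op P (t + s) f x - semigroup_op P t f x - s * semigroup_op P t g x\<bar> \<le> e" for x
      by simp
    then have "\<bar>LINT x|\<pi>. semigroup_op P (t + s) f x - semigroup_op P t f x - s * semigroup_op P t g x\<bar> \<le> e"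
      by (rule config_dist_integral(2)[OF \<pi>, rotated]) (intro continuous_intros continuous_on_apply_bcontfun)
    then show ?thesis
      by (simp add: F_def int null[OF generator_semigroup_op[OF P fg st(2)]])
  qed
  have "\<bar>F t - F 0\<bar> \<le> 0 + e" if "0 < e" for e
  proof -
    \<comment> \<open>Dividing by \<open>t + 1\<close> instead of \<open>t\<close> keeps \<open>e'\<close> defined and positive for \<open>t = 0\<close> as well.\<close>
    define e' where "e' = e / (t + 1)"
    have "0 < e'" using t that by (simp add: e'_def)
    from generator_increment[OF P fg this] obtain \<delta> where \<delta>: "0 < \<delta>"
      "\<And>s x. 0 < s \<Longrightarrow> s < \<delta> \<Longrightarrow> \<bar>semigroup_op P s f x - f x - s * g x\<bar> \<le> e' * s" by blast
    show ?thesis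
    proof (cases "t = 0")
      case False
      then have "0 < t" using t by simp
      obtain n where n: "t < real n * \<delta>"
        using reals_Archimedean3[OF \<delta>(1)] by blast
      then have n0: "0 < real n" using \<open>0 < t\<close> by (cases n) auto
      define s where "s = t / real n"
      have s: "0 < s" "s < \<delta>" using n n0 \<open>0 < t\<close> by (auto simp: s_def field_simps)
      have "\<bar>F (real k * s) - F 0\<bar> \<le> real k * (e' * s)" for k
      proof (induction k)
        case (Suc k)
        have "\<bar>F (real k * s + s) - F (real k * s)\<bar> \<le> e' * s"
          using s by (intro F_step \<delta>(2)) auto
        with Suc show ?case by (simp add: algebra_simps)
      qed simp
      from this[of n] have "\<bar>F t - F 0\<bar> \<le> e' * t"
        using n0 by (simp add: s_def mult.commute)
      also have "\<dots> \<le> e" using t that by (simp add: e'_def field_simps)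
      finally show ?thesis by simp
    qed (use that in simp)
  qed
  then have "\<bar>F t - F 0\<bar> \<le> 0" by (rule field_le_epsilon)
  moreover have "F 0 = (LINT x|\<pi>. f x)"
  proof -
    have "semigroup_op P 0 f x = f x" for x
    proof -
      have "P 0 x = return borel x" using P by (simp add: feller_transition_def)
      moreover have "apply_bcontfun f \<in> borel_measurable borel"
        by (rule borel_measurable_continuous_onI) simp
      ultimately show ?thesis
        by (simp add: apply_semigroup_op[OF P] integral_return)
    qed
    then have "semigroup_op P 0 f = f" by (rule bcontfun_eqI)
    then show ?thesis by (simp add: F_def)
  qed
  moreover have "apply_bcontfun (semigroup_op P t f) = (\<lambda>x. LINT y|P t x. f y)"
    by (rule ext) (rule apply_semigroup_op[OF P t])
  ultimately show ?thesis by (simp add: F_def)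
qed

lemma infsum_spin_generator:
  assumes "finite J" "depends_on J f"
  shows "(\<Sum>\<^sub>\<infinity>i. spin_rate p x i * (f (flip x i) - f x)) = spin_generator p J f x"
proof -
  have "f (flip x i) = f x" if "i \<notin> J" for i
    by (rule depends_on_flip_outside[OF assms(2) that])
  then show ?thesis
    unfolding spin_generator_def using assms(1)
    by (subst infsum_cong_neutral[where T = J and g = "\<lambda>i. spin_rate p x i * (f (flip x i) - f x)"]) auto
qed

lemma cylinder_generator:
  assumes "finite J" "depends_on J f"
  shows "(Bcontfun f, Bcontfun (spin_generator p J f)) \<in> spin_pregenerator p"
    and "apply_bcontfun (Bcontfun f) = f"
proof -
  have b: "f \<in> bcontfun" if "finite J" "depends_on J f" for J f
    using continuous_on_cylinder[OF that] depends_on_bounded[OF that] by (simp add: bcontfun_def)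
  note f = Bcontfun_inverse[OF b[OF assms]]
  note g = Bcontfun_inverse[OF b[OF _ depends_on_spin_generator[OF assms(2)]], of p]
  show "apply_bcontfun (Bcontfun f) = f" by (rule f)
  show "(Bcontfun f, Bcontfun (spin_generator p J f)) \<in> spin_pregenerator p"
    unfolding spin_pregenerator_def cylinder_fun_def using assms
    by (auto simp: f g depends_on_def infsum_spin_generator)
qed

lemma spin_pregenerator_cylinder:
  assumes "(f, g) \<in> spin_pregenerator p"
  obtains J where "finite J" "depends_on J f" "apply_bcontfun g = spin_generator p J f"
proof -
  obtain J where J: "finite J" "depends_on J f"
    using assms by (auto simp: spin_pregenerator_def cylinder_fun_def depends_on_def)
  have "apply_bcontfun g = spin_generator p J f"
    using assms by (auto simp: spin_pregenerator_def fun_eq_iff infsum_spin_generator[OF J])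
  with J show ?thesis by (rule that)
qed

text \<open>
  It suffices that \<open>\<pi>\<close> annihilates the generator on functions of finitely many coordinates: integration
  is continuous in the sup norm, so this extends to the closure of the pregenerator.
  Stationarity is then tested on indicators of cylinder sets, which lie in the domain of the generator
  and determine the measure.
\<close>

lemma spin_stationary:
  assumes P: "spin_system p P" and \<pi>: "config_dist \<pi>"
    and inv: "\<And>J f. finite J \<Longrightarrow> depends_on J f \<Longrightarrow> (LINT x|\<pi>. spin_generator p J f x) = 0"
  shows "process_stationary P \<pi>"
  unfolding process_stationary_def
proof (intro conjI allI impI \<pi>)
  have feller: "feller_transition P" and gen: "generator P = closure (spin_pregenerator p)"
    using P by (auto simp: spin_system_def)
  have null: "(LINT x|\<pi>. g x) = 0" if "(f, g) \<in> generator P" for f g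
  proof -
    have "\<bar>LINT x|\<pi>. g x\<bar> \<le> 0 + e" if "0 < e" for e
    proof -
      obtain f' g' where fg': "(f', g') \<in> spin_pregenerator p" "dist (f', g') (f, g) < e"
        using \<open>(f, g) \<in> generator P\<close> \<open>0 < e\<close> unfolding gen closure_approachable by (metis surj_pair)
      obtain J where J: "finite J" "depends_on J f'" "apply_bcontfun g' = spin_generator p J f'"
        using spin_pregenerator_cylinder[OF fg'(1)] .
      have "dist (g' x) (g x) \<le> e" for x
        using dist_bounded[of g' x g] dist_snd_le[of "(f', g')" "(f, g)"] fg'(2) by simp
      then have "\<bar>LINT x|\<pi>. g' x - g x\<bar> \<le> e"
        by (intro config_dist_integral(2)[OF \<pi>] continuous_intros continuous_on_apply_bcontfun)
           (simp add: dist_real_def)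
      moreover have "(LINT x|\<pi>. g' x) = 0"
        using inv[OF J(1,2)] J(3) by simp
      ultimately show ?thesis
        by (simp add: config_dist_integrable[OF \<pi>])
    qed
    then have "\<bar>LINT x|\<pi>. g x\<bar> \<le> 0" by (rule field_le_epsilon)
    then show ?thesis by simp
  qed
  fix t :: real assume t: "0 \<le> t"
  have Pt: "P t \<in> borel \<rightarrow>\<^sub>M prob_algebra borel"
    using feller t by (simp add: feller_transition_def)
  have \<pi>': "prob_space \<pi>" "sets \<pi> = sets borel"
    using \<pi> by (auto simp: config_dist_def space_prob_algebra)
  have prob: "prob_space (\<pi> \<bind> P t)"
    using prob_space_bind'[OF _ Pt] \<pi> by (simp add: config_dist_def)
  have sets: "sets (\<pi> \<bind> P t) = sets borel"
    using sets_bind'[OF _ Pt] \<pi> by (simp add: config_dist_def)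
  show "\<pi> \<bind> P t = \<pi>"
  proof (rule measure_eqI_generator_eq[where E = cylinder_sets and \<Omega> = UNIV and A = "\<lambda>_. UNIV"])
    interpret algebra UNIV cylinder_sets by (rule algebra_cylinder_sets)
    show "Int_stable cylinder_sets" by (auto simp: Int_stable_def)
    show "range (\<lambda>_. UNIV) \<subseteq> cylinder_sets" using top by auto
    show "emeasure (\<pi> \<bind> P t) A = emeasure \<pi> A" if A: "A \<in> cylinder_sets" for A
    proof -
      obtain J where J: "finite J" "depends_on J (indicator A)"
        using A by (auto simp: cylinder_sets_def)
      have A': "A \<in> sets borel" using open_cylinder_set[OF A] by simp
      define f where "f = Bcontfun (indicator A :: config \<Rightarrow> real)"
      note f = cylinder_generator(2)[OF J, folded f_def]
      have "(f, Bcontfun (spin_generator p J (indicator A))) \<in> generator P"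
        unfolding gen f_def using cylinder_generator(1)[OF J] closure_subset by blast
      from integral_semigroup_op_invariant[OF feller \<pi> null this t]
      have "(LINT y|(\<pi> \<bind> P t). f y) = (LINT x|\<pi>. f x)"
        by (simp add: feller_integral_bind[OF feller t \<pi>])
      then have "measure (\<pi> \<bind> P t) A = measure \<pi> A"
        using A' by (simp add: f sets \<pi>'(2) sets_eq_imp_space_eq[OF sets] sets_eq_imp_space_eq[OF \<pi>'(2)])
      then show ?thesis
        using prob \<pi>'(1) by (simp add: finite_measure.emeasure_eq_measure prob_space.finite_measure)
    qed
    show "emeasure (\<pi> \<bind> P t) UNIV \<noteq> \<infinity>" for i :: nat
      using prob by (simp add: finite_measure.emeasure_finite prob_space.finite_measure)
  qed (auto simp: sets \<pi>'(2) sigma_cylinder_sets)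
qed

section \<open>Convergence of the mean profit\<close>

lemma convergent_mean_profit_ergodic:
  assumes erg: "\<And>N. N \<ge> 3 \<Longrightarrow> player_ergodic p N" and P: "spin_system p P" "process_ergodic P"
  shows "convergent (\<lambda>N. mean_profit N p)"
proof -
  have "\<forall>N. \<exists>\<pi>. N \<ge> 3 \<longrightarrow> player_stationary p N \<pi> \<and> (\<forall>\<pi>'. player_stationary p N \<pi>' \<longrightarrow> \<pi>' = \<pi>)"
    using erg unfolding player_ergodic_def by blast
  then obtain \<pi> where \<pi>: "\<And>N. N \<ge> 3 \<Longrightarrow> player_stationary p N (\<pi> N)"
    "\<And>N \<pi>'. N \<ge> 3 \<Longrightarrow> player_stationary p N \<pi>' \<Longrightarrow> \<pi>' = \<pi> N"
    by metis
  obtain \<sigma> where \<sigma>: "\<And>\<sigma>'. process_stationary P \<sigma>' \<Longrightarrow> \<sigma>' = \<sigma>"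
    using P(2) unfolding process_ergodic_def by blast
  let ?\<phi> = "\<lambda>x::config. 2 * p (nbr_code (x (- 1)) (x 1)) - 1"
  have "(\<lambda>N. mean_profit N p) \<longlonglongrightarrow> (LINT x|\<sigma>. ?\<phi> x)"
  proof (rule mean_profit_tendsto[OF \<pi>])
    fix \<Lambda> assume \<Lambda>: "mean_functional \<Lambda>"
      "\<And>J f. finite J \<Longrightarrow> depends_on J f \<Longrightarrow> \<Lambda> (spin_generator p J f) = 0"
    obtain \<rho> where \<rho>: "config_dist \<rho>"
      "\<And>J f. finite J \<Longrightarrow> depends_on J f \<Longrightarrow> (LINT x|\<rho>. f x) = \<Lambda> f"
      using mean_functional_measure[OF \<Lambda>(1)] by blast
    have "process_stationary P \<rho>"
    proof (rule spin_stationary[OF P(1) \<rho>(1)])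
      fix J f assume J: "finite J" "depends_on J f"
      then show "(LINT x|\<rho>. spin_generator p J f x) = 0"
        using \<rho>(2)[OF _ depends_on_spin_generator[OF J(2)], of p] \<Lambda>(2)[OF J] by simp
    qed
    then have "\<rho> = \<sigma>" by (rule \<sigma>)
    moreover have "depends_on {- 1, 1} ?\<phi>" by (simp add: depends_on_def)
    ultimately show "\<Lambda> ?\<phi> = (LINT x|\<sigma>. ?\<phi> x)"
      using \<rho>(2)[of "{- 1, 1}" ?\<phi>] by simp
  qed auto
  then show ?thesis by (rule convergentI)
qed

theorem theorem10:
  fixes p :: "nat \<Rightarrow> real"
  assumes "\<And>m. m \<in> {0, 1, 2, 3} \<Longrightarrow> p m \<in> {0..1}"
  shows
    "((\<forall>N\<ge>3. player_ergodic p N) \<and> (\<exists>P. spin_system p P \<and> process_ergodic P)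
        \<longrightarrow> convergent (\<lambda>N. mean_profit N p)) \<and>
     ((p 0, p 1, p 2, p 3) \<notin> {(0, 0, 1, 0), (0, 1, 0, 0), (1, 0, 1, 1), (1, 1, 0, 1)}
        \<longrightarrow> convergent (\<lambda>N. mean_profit N (\<lambda>m. 1/2 * (1/2 + p m))))"
proof (intro conjI impI)
  assume "(\<forall>N\<ge>3. player_ergodic p N) \<and> (\<exists>P. spin_system p P \<and> process_ergodic P)"
  then show "convergent (\<lambda>N. mean_profit N p)"
    using convergent_mean_profit_ergodic by blast
next
  show "convergent (\<lambda>N. mean_profit N (\<lambda>m. 1/2 * (1/2 + p m)))"
  proof (rule convergent_mean_profit_noisy)
    fix m :: nat assume "m \<in> {0, 1, 2, 3}"
    with assms[of m] show "1/2 * (1/2 + p m) \<in> {1/4..3/4}" by auto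
  qed
qed

end
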